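(* Let $\phi$ be a monotone 3-CNF formula (no negated variables, each clause has three distinct variables) and let $H_\phi$ be the trapezoid graph constructed from $\phi$ as described in the context. Then $\phi$ is NAE-satisfiable if and only if $H_\phi$ is a bounded tolerance graph.
   Context: A formula is NAE-satisfiable if there is a truth assignment such that every clause contains at least one true and at least one false variable. Tolerance / bounded tolerance graphs: $G$ on $v_1,\dots,v_n$ is a tolerance graph if there are closed intervals $I_i$ and positive reals $t_i$ with $v_iv_j\in E$ iff $|I_i\cap I_j|\ge\min\{t_i,t_j\}$; it is bounded tolerance if moreover $t_i\le |I_i|$ for all $i$. Representations: $L_1,L_2$ are two horizontal parallel lines. A permutation representation is a set of line segments ("lines") each joining a point of $L_1$ to a point of $L_2$, all endpoints distinct; its graph has the lines as vertices, adjacent iff they cross. $\theta(\ell)$ denotes the angle of line $\ell$ with $L_2$. A trapezoid with left line $p$ and right line $q$ (non-crossing, $p$ left of $q$) is the region between them; a trapezoid graph is the intersection graph of such trapezoids; a parallelogram is a trapezoid whose two lines are parallel. Construction of $R_P$ (and $P_\phi$): let $\phi=\alpha_1\wedge\cdots\wedge\alpha_k$ over variables $x_1,\ldots,x_n$, $\alpha_i=(x_{r_{i,1}}\vee x_{r_{i,2}}\vee x_{r_{i,3}})$ with $r_{i,1}<r_{i,2}<r_{i,3}$. For each occurrence $(i,j)$, $j\in\{1,2,3\}$, take a pair of crossing lines $\ell^1_{i,j},\ell^2_{i,j}$ with $\theta(\ell^1_{i,j})>\theta(\ell^2_{i,j})$; write $(a_i,c_i)=(\ell^1_{i,1},\ell^2_{i,1})$,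 $(e_i,b_i)=(\ell^1_{i,2},\ell^2_{i,2})$, $(d_i,f_i)=(\ell^1_{i,3},\ell^2_{i,3})$. Lines of different occurrences do not cross. Occurrences of variable $x_p$ lie completely to the left of occurrences of $x_{p'}$ whenever $p<p'$; occurrences of the same variable are in an arbitrary left-to-right order. For every two consecutive occurrences $(i,j)$ (left) and $(i',j')$ (right) of the same variable, add two parallel lines $u^{i',j'}_{i,j},v^{i',j'}_{i,j}$, each crossing both $\ell^1_{i,j}$ and $\ell^1_{i',j'}$ and no other line, with $\theta(\ell^1_{i,j})>\theta(u^{i',j'}_{i,j})=\theta(v^{i',j'}_{i,j})<\theta(\ell^1_{i',j'})$. This is $R_P$, with $2m$ lines, $m=6k-n$. Group the lines into $m$ pairs: $\{a_i,b_i\},\{c_i,d_i\},\{e_i,f_i\}$ for each clause, and $\{u^{i',j'}_{i,j},v^{i',j'}_{i,j}\}$ for each added pair; call them $\{u_t^1,u_t^2\}$, $t=1,\ldots,m$, with $u_t^1$ the left one of the two (non-crossing) lines. Construction of $G_\phi$ and $H_\phi$: replace in $R_P$ each pair $\{u_t^1,u_t^2\}$ by the trapezoid $T_{u_t}$ with left line $u_t^1$ and right line $u_t^2$; this gives a trapezoid representation $R_G$ of the trapezoid graph $G_\phi$ on $m$ vertices. Then for $t=1,\ldots,m$ in turn: let $\varepsilon$ be the smallest distance between two distinct endpoints on $L_1$ or on $L_2$ in the current representation, and add six parallelograms, each of whose lines is a horizontal translate of $u_t^1$ or $u_t^2$: $T_{u_{t,1}}$ has left and right lines at distance $\varepsilon/2$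 to the left and to the right of $u_t^1$; $T_{u_{t,2}}$ has right line at distance $\varepsilon/4$ and left line at distance $3\varepsilon/4$ to the left of $u_t^1$; $T_{u_{t,3}}$ has right line at distance $3\varepsilon/8$ and left line at distance $7\varepsilon/8$ to the left of $u_t^1$; $T_{u_{t,4}}$ has left and right lines at distance $\varepsilon/2$ to the left and to the right of $u_t^2$; $T_{u_{t,5}}$ has left line at distance $\varepsilon/4$ and right line at distance $3\varepsilon/4$ to the right of $u_t^2$; $T_{u_{t,6}}$ has left line at distance $3\varepsilon/8$ and right line at distance $7\varepsilon/8$ to the right of $u_t^2$. The resulting trapezoid graph on $7m$ vertices is $H_\phi$. *)

theory Defs
  imports "HOL-Analysis.Analysis"
begin

section \<open>Monotone 3-CNF formulas\<close>

text \<open>Variables are natural numbers, a clause without negations is its set of variables.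
  Clauses form a list, so that they carry an index and may be repeated.\<close>

type_synonym formula = "nat set list"

definition monotone_3cnf :: "formula \<Rightarrow> bool" where
  "monotone_3cnf \<phi> \<longleftrightarrow> (\<forall>C\<in>set \<phi>. finite C \<and> card C = 3)"

definition nae_satisfiable :: "formula \<Rightarrow> bool" where
  "nae_satisfiable \<phi> \<longleftrightarrow>
     (\<exists>\<tau> :: nat \<Rightarrow> bool. \<forall>C\<in>set \<phi>. (\<exists>x\<in>C. \<tau> x) \<and> (\<exists>x\<in>C. \<not> \<tau> x))"

section \<open>Tolerance graphs\<close>

type_synonym 'a graph = "'a set \<times> 'a set set"

definition tolerance_representation ::
  "'a graph \<Rightarrow> ('a \<Rightarrow> real set) \<Rightarrow> ('a \<Rightarrow> real) \<Rightarrow> bool" where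
  "tolerance_representation G I t \<longleftrightarrow>
     (\<forall>v\<in>fst G. (\<exists>a b. a \<le> b \<and> I v = {a..b}) \<and> 0 < t v) \<and>
     (\<forall>u\<in>fst G. \<forall>v\<in>fst G. u \<noteq> v \<longrightarrow>
        ({u, v} \<in> snd G \<longleftrightarrow> min (t u) (t v) \<le> measure lborel (I u \<inter> I v)))"

definition tolerance_graph :: "'a graph \<Rightarrow> bool" where
  "tolerance_graph G \<longleftrightarrow> (\<exists>I t. tolerance_representation G I t)"

definition bounded_tolerance_graph :: "'a graph \<Rightarrow> bool" where
  "bounded_tolerance_graph G \<longleftrightarrow>
     (\<exists>I t. tolerance_representation G I t \<and> (\<forall>v\<in>fst G. t v \<le> measure lborel (I v)))"

section \<open>Lines and trapezoids between two horizontal lines\<close>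

text \<open>In the complex plane, L1 is the line of imaginary part 1 and L2 the real axis.
  The pair \<open>(x, y)\<close> stands for the segment from the point at abscissa \<open>x\<close> of L1
  to the point at abscissa \<open>y\<close> of L2.\<close>

type_synonym line = "real \<times> real"

definition segment :: "line \<Rightarrow> complex set" where
  "segment p = closed_segment (Complex (fst p) 1) (Complex (snd p) 0)"

definition crosses :: "line \<Rightarrow> line \<Rightarrow> bool" where
  "crosses p q \<longleftrightarrow> segment p \<inter> segment q \<noteq> {}"

definition left_of :: "line \<Rightarrow> line \<Rightarrow> bool" where
  "left_of p q \<longleftrightarrow> fst p < fst q \<and> snd p < snd q"

text \<open>The angle in \<open>(0, \<pi>)\<close> with the positive direction of L2.\<close>

definition theta :: "line \<Rightarrow> real" where
  "theta p = Arg (Complex (fst p) 1 - Complex (snd p) 0)"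

definition shift :: "real \<Rightarrow> line \<Rightarrow> line" where
  "shift d p = (fst p + d, snd p + d)"

text \<open>A trapezoid is given by its left and its right line.  The region consists of the points
  strictly between them: two trapezoids that merely touch along their boundaries do not
  intersect.  When all endpoints are distinct this is the same as intersection of the closed
  regions.  It matters only if the smallest distance \<open>\<epsilon>\<close> used in \<open>add_six\<close> below is
  attained, on L1 or on L2, by the two lines of the very pair being processed: then the first
  and the fourth new parallelogram touch there.\<close>

type_synonym trapezoid = "line \<times> line"

definition abscissa :: "line \<Rightarrow> real \<Rightarrow> real" where
  "abscissa p h = h * fst p + (1 - h) * snd p"

definition region :: "trapezoid \<Rightarrow> complex set" where
  "region T = {z. 0 \<le> Im z \<and> Im z \<le> 1 \<and>
      abscissa (fst T) (Im z) < Re z \<and> Re z < abscissa (snd T) (Im z)}"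

definition trapezoid_graph :: "('a \<Rightarrow> trapezoid option) \<Rightarrow> 'a graph" where
  "trapezoid_graph \<rho> = (dom \<rho>,
     {{u, v} | u v. u \<in> dom \<rho> \<and> v \<in> dom \<rho> \<and> u \<noteq> v \<and>
        region (the (\<rho> u)) \<inter> region (the (\<rho> v)) \<noteq> {}})"

section \<open>The permutation representation of a formula\<close>

text \<open>An occurrence is a pair \<open>(i, j)\<close> of a clause index and a position in the clause, both
  counted from 0; the variables of a clause are taken in increasing order.\<close>

type_synonym occ = "nat \<times> nat"

definition occs :: "formula \<Rightarrow> occ set" where
  "occs \<phi> = {..<length \<phi>} \<times> {..<3}"

definition var :: "formula \<Rightarrow> occ \<Rightarrow> nat" where
  "var \<phi> x = sorted_list_of_set (\<phi> ! fst x) ! snd x"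

text \<open>\<open>Ell1 x\<close> and \<open>Ell2 x\<close> are the two crossing lines of the occurrence \<open>x\<close>;
  \<open>LinkU x y\<close> and \<open>LinkV x y\<close> are the two parallel lines added for consecutive
  occurrences \<open>x\<close> (left) and \<open>y\<close> (right) of the same variable.\<close>

datatype line_id = Ell1 occ | Ell2 occ | LinkU occ occ | LinkV occ occ

definition occ_left :: "(line_id \<Rightarrow> line) \<Rightarrow> occ \<Rightarrow> occ \<Rightarrow> bool" where
  "occ_left R x y \<longleftrightarrow> (\<forall>p\<in>{Ell1 x, Ell2 x}. \<forall>q\<in>{Ell1 y, Ell2 y}. left_of (R p) (R q))"

definition consecutive :: "formula \<Rightarrow> (line_id \<Rightarrow> line) \<Rightarrow> occ \<Rightarrow> occ \<Rightarrow> bool" where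
  "consecutive \<phi> R x y \<longleftrightarrow>
     x \<in> occs \<phi> \<and> y \<in> occs \<phi> \<and> var \<phi> x = var \<phi> y \<and> occ_left R x y \<and>
     \<not> (\<exists>z\<in>occs \<phi>. var \<phi> z = var \<phi> x \<and> occ_left R x z \<and> occ_left R z y)"

definition line_ids :: "formula \<Rightarrow> (line_id \<Rightarrow> line) \<Rightarrow> line_id set" where
  "line_ids \<phi> R = Ell1 ` occs \<phi> \<union> Ell2 ` occs \<phi> \<union>
     {LinkU x y | x y. consecutive \<phi> R x y} \<union> {LinkV x y | x y. consecutive \<phi> R x y}"

text \<open>The coordinates, and the order of the occurrences of the same variable, are left open
  by the construction.  Hence \<open>R\<close> is any representation with the required properties; only
  its values on \<open>line_ids \<phi> R\<close> are relevant.\<close>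

definition perm_representation :: "formula \<Rightarrow> (line_id \<Rightarrow> line) \<Rightarrow> bool" where
  "perm_representation \<phi> R \<longleftrightarrow>
     inj_on (\<lambda>l. fst (R l)) (line_ids \<phi> R) \<and>
     inj_on (\<lambda>l. snd (R l)) (line_ids \<phi> R) \<and>
     (\<forall>x\<in>occs \<phi>. crosses (R (Ell1 x)) (R (Ell2 x)) \<and>
        theta (R (Ell1 x)) > theta (R (Ell2 x))) \<and>
     (\<forall>x\<in>occs \<phi>. \<forall>y\<in>occs \<phi>. x \<noteq> y \<longrightarrow>
        (\<forall>p\<in>{Ell1 x, Ell2 x}. \<forall>q\<in>{Ell1 y, Ell2 y}. \<not> crosses (R p) (R q))) \<and>
     (\<forall>x\<in>occs \<phi>. \<forall>y\<in>occs \<phi>. var \<phi> x < var \<phi> y \<longrightarrow> occ_left R x y) \<and>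
     (\<forall>x y. consecutive \<phi> R x y \<longrightarrow>
        theta (R (Ell1 x)) > theta (R (LinkU x y)) \<and>
        theta (R (LinkU x y)) = theta (R (LinkV x y)) \<and>
        theta (R (LinkV x y)) < theta (R (Ell1 y)) \<and>
        (\<forall>w\<in>{LinkU x y, LinkV x y}. \<forall>l\<in>line_ids \<phi> R - {w}.
           crosses (R w) (R l) \<longleftrightarrow> l \<in> {Ell1 x, Ell1 y}))"

text \<open>With \<open>(a, c)\<close>, \<open>(e, b)\<close>, \<open>(d, f)\<close> the line pairs of the three occurrences in a
  clause, the groups of that clause are \<open>{a, b}\<close>, \<open>{c, d}\<close>, \<open>{e, f}\<close>.\<close>

definition line_groups :: "formula \<Rightarrow> (line_id \<Rightarrow> line) \<Rightarrow> line_id set set" where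
  "line_groups \<phi> R =
     (\<Union>i<length \<phi>. {{Ell1 (i, 0), Ell2 (i, 1)},
                     {Ell2 (i, 0), Ell1 (i, 2)},
                     {Ell1 (i, 1), Ell2 (i, 2)}}) \<union>
     {{LinkU x y, LinkV x y} | x y. consecutive \<phi> R x y}"

text \<open>An enumeration of the groups; the left line of each group is the first component.\<close>

definition enumerates_groups ::
  "formula \<Rightarrow> (line_id \<Rightarrow> line) \<Rightarrow> (line_id \<times> line_id) list \<Rightarrow> bool" where
  "enumerates_groups \<phi> R ps \<longleftrightarrow> distinct ps \<and>
     set ps = {(p, q). {p, q} \<in> line_groups \<phi> R \<and> left_of (R p) (R q)}"

section \<open>The trapezoid graphs of a formula\<close>

text \<open>The vertex \<open>(t, 0)\<close> is the trapezoid of the \<open>t\<close>-th group, and \<open>(t, s)\<close> for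
  \<open>1 \<le> s \<le> 6\<close> are the six parallelograms added for it.\<close>

type_synonym vertex = "nat \<times> nat"

definition R_G ::
  "(line_id \<Rightarrow> line) \<Rightarrow> (line_id \<times> line_id) list \<Rightarrow> vertex \<Rightarrow> trapezoid option" where
  "R_G R ps = (\<lambda>(t, s). if t < length ps \<and> s = 0 then Some (map_prod R R (ps ! t)) else None)"

definition endpoints1 :: "(vertex \<Rightarrow> trapezoid option) \<Rightarrow> real set" where
  "endpoints1 \<rho> = (\<Union>T\<in>ran \<rho>. {fst (fst T), fst (snd T)})"

definition endpoints2 :: "(vertex \<Rightarrow> trapezoid option) \<Rightarrow> real set" where
  "endpoints2 \<rho> = (\<Union>T\<in>ran \<rho>. {snd (fst T), snd (snd T)})"

definition min_distance :: "(vertex \<Rightarrow> trapezoid option) \<Rightarrow> real" where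
  "min_distance \<rho> = Min
     ({dist x y | x y. x \<in> endpoints1 \<rho> \<and> y \<in> endpoints1 \<rho> \<and> x \<noteq> y} \<union>
      {dist x y | x y. x \<in> endpoints2 \<rho> \<and> y \<in> endpoints2 \<rho> \<and> x \<noteq> y})"

definition add_six ::
  "nat \<Rightarrow> line \<times> line \<Rightarrow> (vertex \<Rightarrow> trapezoid option) \<Rightarrow> vertex \<Rightarrow> trapezoid option" where
  "add_six t u \<rho> = (let \<epsilon> = min_distance \<rho>; p = fst u; q = snd u in
     \<rho>((t, 1) \<mapsto> (shift (- (\<epsilon> / 2)) p, shift (\<epsilon> / 2) p),
       (t, 2) \<mapsto> (shift (- (3 * \<epsilon> / 4)) p, shift (- (\<epsilon> / 4)) p),
       (t, 3) \<mapsto> (shift (- (7 * \<epsilon> / 8)) p, shift (- (3 * \<epsilon> / 8)) p),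
       (t, 4) \<mapsto> (shift (- (\<epsilon> / 2)) q, shift (\<epsilon> / 2) q),
       (t, 5) \<mapsto> (shift (\<epsilon> / 4) q, shift (3 * \<epsilon> / 4) q),
       (t, 6) \<mapsto> (shift (3 * \<epsilon> / 8) q, shift (7 * \<epsilon> / 8) q)))"

primrec R_H_upto ::
  "(line_id \<Rightarrow> line) \<Rightarrow> (line_id \<times> line_id) list \<Rightarrow> nat \<Rightarrow> vertex \<Rightarrow> trapezoid option" where
  "R_H_upto R ps 0 = R_G R ps"
| "R_H_upto R ps (Suc t) = add_six t (map_prod R R (ps ! t)) (R_H_upto R ps t)"

definition H_graph :: "(line_id \<Rightarrow> line) \<Rightarrow> (line_id \<times> line_id) list \<Rightarrow> vertex graph" where
  "H_graph R ps = trapezoid_graph (R_H_upto R ps (length ps))"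

end

theory Submission
  imports Defs
begin

text \<open>
  A bounded tolerance representation is the same as a representation by parallelograms, in which
  both lines of every group have the same slope.

  Suppose \<open>H\<close> has such a representation.  For each line of the permutation representation, the
  trapezoid of its group and the parallelogram on the outer side of the line are disjoint, and
  the gap between them contains a line with the slope of the group.  Lines that cross originally
  give lines that cross, and if one line crosses two non-crossing ones then its slope is below
  both or above both.  Following the links, the comparison of the slopes of \<open>Ell1 x\<close> and
  \<open>Ell2 x\<close> depends only on the variable of \<open>x\<close>, which defines an assignment.  A clause whose
  variables have equal values would make the slopes of its three groups increase cyclically.

  Conversely, an assignment prescribes the order of the three slopes in each clause, without cycles
  if no clause is constant.  Small slopes in that order are given to the lines of the occurrences,
  which are placed far apart from each other; the slopes of the links are unconstrained.  The
  resulting lines have the same left-to-right relation as the original ones, and this relation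
  determines \<open>H\<close>.
\<close>

section \<open>Lines and trapezoids\<close>

lemma mem_segment_iff:
  "z \<in> segment p \<longleftrightarrow> 0 \<le> Im z \<and> Im z \<le> 1 \<and> Re z = abscissa p (Im z)"
proof
  assume "z \<in> segment p"
  then obtain u where "0 \<le> u" "u \<le> 1"
    "z = (1 - u) *\<^sub>R Complex (fst p) 1 + u *\<^sub>R Complex (snd p) 0"
    by (auto simp: segment_def closed_segment_def)
  then show "0 \<le> Im z \<and> Im z \<le> 1 \<and> Re z = abscissa p (Im z)"
    by (simp add: abscissa_def)
next
  assume *: "0 \<le> Im z \<and> Im z \<le> 1 \<and> Re z = abscissa p (Im z)"
  then have "z = (1 - (1 - Im z)) *\<^sub>R Complex (fst p) 1 + (1 - Im z) *\<^sub>R Complex (snd p) 0"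
    by (intro complex_eqI) (auto simp: abscissa_def)
  with * show "z \<in> segment p"
    unfolding segment_def closed_segment_def
    by (smt (verit) mem_Collect_eq)
qed

lemma left_of_not_crosses: "left_of p q \<Longrightarrow> \<not> crosses p q"
proof
  assume l: "left_of p q" and "crosses p q"
  then obtain z where z: "z \<in> segment p" "z \<in> segment q"
    by (auto simp: crosses_def)
  then have h: "0 \<le> Im z" "Im z \<le> 1" and
    eq: "Im z * (fst q - fst p) + (1 - Im z) * (snd q - snd p) = 0"
    by (auto simp: mem_segment_iff abscissa_def algebra_simps)
  have "0 \<le> Im z * (fst q - fst p)" "0 \<le> (1 - Im z) * (snd q - snd p)"
    using h l by (auto simp: left_of_def)
  with eq have "Im z * (fst q - fst p) = 0" "(1 - Im z) * (snd q - snd p) = 0"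
    by linarith+
  with l show False by (auto simp: left_of_def)
qed

lemma crosses_commute: "crosses p q \<longleftrightarrow> crosses q p"
  by (auto simp: crosses_def)

lemma opposite_order_crosses:
  assumes "fst p < fst q" "snd q < snd p"
  shows "crosses p q"
proof -
  define d where "d = (fst q - fst p) + (snd p - snd q)"
  \<comment> \<open>The horizontal distance of the two lines is affine in the height and has
    opposite signs on L1 and L2; this is its zero.\<close>
  define h where "h = (snd p - snd q) / d"
  have d: "d > 0" using assms by (simp add: d_def)
  have h: "0 \<le> h" "h \<le> 1" using assms d by (auto simp: h_def d_def)
  have "h * d = snd p - snd q" using d by (simp add: h_def)
  then have "abscissa p h = abscissa q h"
    unfolding d_def abscissa_def by (simp add: algebra_simps)
  with h have "Complex (abscissa p h) h \<in> segment p \<inter> segment q"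
    by (auto simp: mem_segment_iff)
  then show ?thesis by (auto simp: crosses_def)
qed

lemma crosses_iff:
  assumes "fst p \<noteq> fst q" "snd p \<noteq> snd q"
  shows "crosses p q \<longleftrightarrow> \<not> left_of p q \<and> \<not> left_of q p"
  using assms left_of_not_crosses opposite_order_crosses crosses_commute
  by (metis left_of_def linorder_neqE_linordered_idom)

section \<open>Slopes and angles\<close>

definition slope :: "line \<Rightarrow> real" where
  "slope p = fst p - snd p"

lemma slope_shift [simp]: "slope (shift d p) = slope p"
  by (simp add: slope_def shift_def)

lemma theta_bounds: "0 < theta p" "theta p < pi"
  using Arg_lt_pi[of "Complex (fst p) 1 - Complex (snd p) 0"]
  by (auto simp: theta_def)

lemma slope_eq_cot_theta: "slope p = cos (theta p) / sin (theta p)"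
proof -
  define z where "z = Complex (fst p) 1 - Complex (snd p) 0"
  have "z \<noteq> 0" by (auto simp: z_def complex_eq_iff)
  then have z: "z = of_real (cmod z) * exp (\<i> * of_real (theta p))"
    using Arg_eq[of z] by (simp add: z_def theta_def)
  have "Re z = cmod z * cos (theta p)" "Im z = cmod z * sin (theta p)"
    by (subst z; simp add: Re_exp Im_exp)+
  moreover have "Re z = slope p" "Im z = 1" by (auto simp: z_def slope_def)
  ultimately show ?thesis
    by (metis div_by_1 mult_divide_mult_cancel_left mult_zero_left zero_neq_one)
qed

text \<open>\<open>slope\<close> is the cotangent of \<open>theta\<close>, which decreases on the
  interval from 0 to \<open>pi\<close>: the difference of two cotangents has the sign of the sine of
  the difference of the angles.\<close>

lemma theta_less_imp_slope_less:
  assumes "theta p < theta q"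
  shows "slope q < slope p"
proof -
  have "0 < sin (theta q - theta p)"
    using assms theta_bounds[of p] theta_bounds[of q] by (intro sin_gt_zero) auto
  moreover have "0 < sin (theta p)" "0 < sin (theta q)"
    using theta_bounds[of p] theta_bounds[of q] by (auto intro: sin_gt_zero)
  ultimately show ?thesis
    by (simp add: slope_eq_cot_theta sin_diff field_simps)
qed

section \<open>Weak left-to-right order and disjoint regions\<close>

definition weakly_left_of :: "line \<Rightarrow> line \<Rightarrow> bool" where
  "weakly_left_of p q \<longleftrightarrow> fst p \<le> fst q \<and> snd p \<le> snd q"

lemma abscissa_strict_mono:
  assumes "left_of p q" "0 \<le> h" "h \<le> 1"
  shows "abscissa p h < abscissa q h"
proof (cases "h = 0")
  case False
  then have "h * fst p < h * fst q" "(1 - h) * snd p \<le> (1 - h) * snd q"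
    using assms by (auto simp: left_of_def intro: mult_left_mono)
  then show ?thesis by (simp add: abscissa_def)
qed (use assms in \<open>auto simp: abscissa_def left_of_def\<close>)

lemma abscissa_mono:
  assumes "weakly_left_of p q" "0 \<le> h" "h \<le> 1"
  shows "abscissa p h \<le> abscissa q h"
  using assms by (auto simp: abscissa_def weakly_left_of_def intro!: add_mono mult_left_mono)

text \<open>Disjointness at heights 0 and 1 orders the trapezoids weakly on L1 and on L2. If these
  two orders disagreed, the regions would overlap at some height in between. The order is weak
  because regions are open at their sides.\<close>

lemma region_disjoint_iff:
  assumes "left_of p q" "left_of p' q'"
  shows "region (p, q) \<inter> region (p', q') = {} \<longleftrightarrow> weakly_left_of q p' \<or> weakly_left_of q' p"
proof
  assume "weakly_left_of q p' \<or> weakly_left_of q' p"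
  then show "region (p, q) \<inter> region (p', q') = {}"
  proof
    assume *: "weakly_left_of q p'"
    show ?thesis using abscissa_mono[OF *] by (force simp: region_def)
  next
    assume *: "weakly_left_of q' p"
    show ?thesis using abscissa_mono[OF *] by (force simp: region_def)
  qed
next
  assume empty: "region (p, q) \<inter> region (p', q') = {}"
  have key: False if h: "0 \<le> h" "h \<le> 1"
    and *: "abscissa p' h < abscissa q h" "abscissa p h < abscissa q' h" for h
  proof -
    define x where "x = (max (abscissa p h) (abscissa p' h) + min (abscissa q h) (abscissa q' h)) / 2"
    have "abscissa p h < abscissa q h" "abscissa p' h < abscissa q' h"
      using abscissa_strict_mono assms h by auto
    with * have "Complex x h \<in> region (p, q) \<inter> region (p', q')"
      using h by (auto simp: region_def x_def max_def min_def)
    with empty show False by blast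
  qed
  have ends: "\<not> (fst p' < fst q \<and> fst p < fst q')" "\<not> (snd p' < snd q \<and> snd p < snd q')"
    using key[of 1] key[of 0] by (auto simp: abscissa_def)
  have diagonal: False if "fst q \<le> fst p'" "snd p' < snd q" "fst p < fst q'" "snd q' \<le> snd p"
    and "left_of p q" "left_of p' q'" "\<And>h. 0 \<le> h \<Longrightarrow> h \<le> 1 \<Longrightarrow> abscissa p' h < abscissa q h \<Longrightarrow>
      abscissa p h < abscissa q' h \<Longrightarrow> False" for p q p' q'
  proof -
    define a where "a = snd q - snd p'"
    define b where "b = fst q' - fst p"
    \<comment> \<open>This height balances the overlap \<open>a\<close> on L2 against the overlap
      \<open>b\<close> on L1. Since both trapezoids are proper, \<open>fst p' - fst q < b\<close>
      and \<open>snd p - snd q' < a\<close>, so both overlaps are still positive here.\<close>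
    define h where "h = a / (a + b)"
    have ab: "a > 0" "b > 0" using that by (auto simp: a_def b_def)
    then have h: "0 < h" "h < 1" by (auto simp: h_def)
    have e: "(1 - h) * a = h * b" using ab by (simp add: h_def field_simps)
    have "h * (fst p' - fst q) < h * b"
      using that h by (auto simp: b_def left_of_def)
    then have 1: "abscissa p' h < abscissa q h"
      using e by (simp add: abscissa_def a_def algebra_simps)
    have "(1 - h) * (snd p - snd q') < (1 - h) * a"
      using that h by (auto simp: a_def left_of_def)
    then have 2: "abscissa p h < abscissa q' h"
      using e by (simp add: abscissa_def b_def algebra_simps)
    show False using that(7)[of h] h 1 2 by auto
  qed
  show "weakly_left_of q p' \<or> weakly_left_of q' p"
  proof (rule ccontr)
    assume "\<not> ?thesis"
    with ends have "fst q \<le> fst p' \<and> snd p' < snd q \<and> fst p < fst q' \<and> snd q' \<le> snd p \<or>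
       fst q' \<le> fst p \<and> snd p < snd q' \<and> fst p' < fst q \<and> snd q \<le> snd p'"
      by (auto simp: weakly_left_of_def)
    then show False
      using diagonal[of q p' p q'] diagonal[of q' p p' q] assms key by blast
  qed
qed

lemma trapezoid_graph_edge_iff:
  assumes "u \<in> dom \<rho>" "v \<in> dom \<rho>" "u \<noteq> v"
  shows "{u, v} \<in> snd (trapezoid_graph \<rho>) \<longleftrightarrow> region (the (\<rho> u)) \<inter> region (the (\<rho> v)) \<noteq> {}"
proof
  assume "{u, v} \<in> snd (trapezoid_graph \<rho>)"
  then obtain u' v' where "{u, v} = {u', v'}" "region (the (\<rho> u')) \<inter> region (the (\<rho> v')) \<noteq> {}"
    by (auto simp: trapezoid_graph_def)
  then show "region (the (\<rho> u)) \<inter> region (the (\<rho> v)) \<noteq> {}"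
    by (metis Int_commute doubleton_eq_iff)
next
  assume "region (the (\<rho> u)) \<inter> region (the (\<rho> v)) \<noteq> {}"
  with assms show "{u, v} \<in> snd (trapezoid_graph \<rho>)"
    unfolding trapezoid_graph_def snd_conv by blast
qed

lemma not_weakly_left_imp_slope:
  assumes "\<not> weakly_left_of p q" "\<not> weakly_left_of q p"
  shows "slope p < slope q \<longleftrightarrow> fst p < fst q \<and> snd q < snd p" "slope p \<noteq> slope q"
  using assms by (auto simp: weakly_left_of_def slope_def)

section \<open>Parallelogram representations\<close>

text \<open>Unlike for \<open>region\<close>, touching counts as adjacency, in accordance with the
  non-strict inequality for tolerances. A parallelogram may degenerate to a line, which is the case
  of a tolerance equal to the length.\<close>

definition parallelogram_representation :: "'a graph \<Rightarrow> ('a \<Rightarrow> trapezoid) \<Rightarrow> bool" where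
  "parallelogram_representation G P \<longleftrightarrow>
     (\<forall>v\<in>fst G. slope (fst (P v)) = slope (snd (P v)) \<and> weakly_left_of (fst (P v)) (snd (P v))) \<and>
     (\<forall>u\<in>fst G. \<forall>v\<in>fst G. u \<noteq> v \<longrightarrow>
        ({u, v} \<in> snd G \<longleftrightarrow>
          \<not> left_of (snd (P u)) (fst (P v)) \<and> \<not> left_of (snd (P v)) (fst (P u))))"

text \<open>An interval \<open>[l, r]\<close> with tolerance \<open>t \<le> r - l\<close> corresponds to the parallelogram
  with lines \<open>(l + t, l)\<close> and \<open>(r, r - t)\<close>.\<close>

lemma overlap_less_min_tolerance_iff:
  fixes l r t l' r' t' :: real
  assumes "0 < t" "t \<le> r - l" "0 < t'" "t' \<le> r' - l'"
  shows "measure lborel ({l..r} \<inter> {l'..r'}) < min t t' \<longleftrightarrow>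
    left_of (r, r - t) (l' + t', l') \<or> left_of (r', r' - t') (l + t, l)"
proof -
  have "measure lborel ({l..r} \<inter> {l'..r'}) = max 0 (min r r' - max l l')"
    by (auto simp: Int_atLeastAtMost)
  then show ?thesis using assms
    by (auto simp: left_of_def min_def max_def)
qed

lemma bounded_tolerance_imp_parallelogram:
  assumes "bounded_tolerance_graph G"
  obtains P where "parallelogram_representation G P"
proof -
  from assms obtain I t where rep: "tolerance_representation G I t"
    and le: "\<forall>v\<in>fst G. t v \<le> measure lborel (I v)"
    by (auto simp: bounded_tolerance_graph_def)
  then have "\<forall>v\<in>fst G. \<exists>a b. a \<le> b \<and> I v = {a..b}"
    by (auto simp: tolerance_representation_def)
  then obtain l r where lr: "\<And>v. v \<in> fst G \<Longrightarrow> l v \<le> r v \<and> I v = {l v..r v}"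
    by metis
  have t: "0 < t v" "t v \<le> r v - l v" if "v \<in> fst G" for v
    using that rep le lr[OF that] by (auto simp: tolerance_representation_def)
  have edge: "{u, v} \<in> snd G \<longleftrightarrow> min (t u) (t v) \<le> measure lborel (I u \<inter> I v)"
    if "u \<in> fst G" "v \<in> fst G" "u \<noteq> v" for u v
    using rep that by (auto simp: tolerance_representation_def)
  define P where "P v = ((l v + t v, l v), (r v, r v - t v))" for v
  have "parallelogram_representation G P"
    unfolding parallelogram_representation_def
  proof (intro conjI ballI impI)
    fix u v assume uv: "u \<in> fst G" "v \<in> fst G" "u \<noteq> v"
    then show "({u, v} \<in> snd G) =
       (\<not> left_of (snd (P u)) (fst (P v)) \<and> \<not> left_of (snd (P v)) (fst (P u)))"
      using edge[OF uv] overlap_less_min_tolerance_iff[OF t[OF uv(1)] t[OF uv(2)]] lr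
      by (auto simp: P_def not_less[symmetric])
  qed (use t in \<open>fastforce simp: P_def slope_def weakly_left_of_def\<close>)+
  then show thesis by (rule that)
qed

text \<open>The slope of a parallelogram becomes its tolerance. Translating all endpoints on L1 by
  the constant \<open>M\<close> makes every slope positive and preserves all left-to-right
  relations.\<close>

lemma parallelogram_imp_bounded_tolerance:
  assumes rep: "parallelogram_representation G P" and fin: "finite (fst G)"
  shows "bounded_tolerance_graph G"
proof -
  define M where "M = Max ((\<lambda>v. - slope (fst (P v))) ` fst G) + 1"
  have M: "- slope (fst (P v)) < M" if "v \<in> fst G" for v
  proof -
    have "- slope (fst (P v)) \<le> Max ((\<lambda>v. - slope (fst (P v))) ` fst G)"
      by (rule Max_ge) (use fin that in auto)
    then show ?thesis by (simp add: M_def)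
  qed
  define l where "l v = snd (fst (P v))" for v
  define t where "t v = M + slope (fst (P v))" for v
  define r where "r v = fst (snd (P v)) + M" for v
  have par: "slope (fst (P v)) = slope (snd (P v))" "weakly_left_of (fst (P v)) (snd (P v))"
    if "v \<in> fst G" for v
    using rep that by (auto simp: parallelogram_representation_def)
  have t: "0 < t v" "t v \<le> r v - l v" if "v \<in> fst G" for v
    using M[OF that] par[OF that] by (auto simp: t_def r_def l_def slope_def weakly_left_of_def)
  have left: "left_of (r u, r u - t u) (l v + t v, l v) \<longleftrightarrow> left_of (snd (P u)) (fst (P v))"
    if "u \<in> fst G" for u v
    using par(1)[OF that] by (auto simp: left_of_def t_def r_def l_def slope_def)
  have "tolerance_representation G (\<lambda>v. {l v..r v}) t"
    unfolding tolerance_representation_def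
  proof (intro conjI ballI impI)
    fix v assume v: "v \<in> fst G"
    show "\<exists>a b. a \<le> b \<and> {l v..r v} = {a..b}" "0 < t v"
      using t[OF v] by (auto intro!: exI[of _ "l v"] exI[of _ "r v"])
  next
    fix u v assume uv: "u \<in> fst G" "v \<in> fst G" "u \<noteq> v"
    then have "{u, v} \<in> snd G \<longleftrightarrow>
      \<not> left_of (snd (P u)) (fst (P v)) \<and> \<not> left_of (snd (P v)) (fst (P u))"
      using rep by (auto simp: parallelogram_representation_def)
    then show "({u, v} \<in> snd G) =
      (min (t u) (t v) \<le> measure lborel ({l u..r u} \<inter> {l v..r v}))"
      using overlap_less_min_tolerance_iff[OF t[OF uv(1)] t[OF uv(2)]] left uv
      by (simp only: not_less[symmetric] de_Morgan_disj)
  qed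
  then show ?thesis
    unfolding bounded_tolerance_graph_def using t
    by (intro exI[of _ "\<lambda>v. {l v..r v}"] exI[of _ t]) fastforce
qed

section \<open>Lines separating two trapezoids\<close>

text \<open>Both orders are allowed, since nonadjacency does not tell which trapezoid is on the
  left.\<close>

definition separates :: "line \<Rightarrow> trapezoid \<Rightarrow> trapezoid \<Rightarrow> bool" where
  "separates a A A' \<longleftrightarrow> left_of (snd A) a \<and> left_of a (fst A') \<or> left_of (snd A') a \<and> left_of a (fst A)"

definition meets :: "trapezoid \<Rightarrow> trapezoid \<Rightarrow> bool" where
  "meets A B \<longleftrightarrow> \<not> left_of (snd A) (fst B) \<and> \<not> left_of (snd B) (fst A)"

text \<open>A small translate, into the gap, of the side of \<open>A\<close> that faces
  \<open>A'\<close>. The slope of \<open>A'\<close> may be different.\<close>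

lemma exists_separating_line:
  assumes "\<not> meets A A'" "slope (fst A) = slope (snd A)"
  obtains a where "separates a A A'" "slope a = slope (fst A)"
proof -
  have gap: "\<exists>a. left_of p a \<and> left_of a q \<and> slope a = slope p"
    "\<exists>a. left_of p a \<and> left_of a q \<and> slope a = slope q" if "left_of p q" for p q
  proof -
    define d where "d = min (fst q - fst p) (snd q - snd p) / 2"
    have d: "0 < d" "d < fst q - fst p" "d < snd q - snd p"
      using that by (auto simp: d_def left_of_def min_def)
    show "\<exists>a. left_of p a \<and> left_of a q \<and> slope a = slope p"
      by (rule exI[of _ "shift d p"]) (use d in \<open>auto simp: left_of_def shift_def slope_def\<close>)
    show "\<exists>a. left_of p a \<and> left_of a q \<and> slope a = slope q"
      by (rule exI[of _ "shift (- d) q"]) (use d in \<open>auto simp: left_of_def shift_def slope_def\<close>)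
  qed
  from assms(1) consider "left_of (snd A) (fst A')" | "left_of (snd A') (fst A)"
    by (auto simp: meets_def)
  then show thesis
  proof cases
    case 1
    from gap(1)[OF this] show ?thesis using that assms(2) by (auto simp: separates_def)
  next
    case 2
    from gap(2)[OF this] show ?thesis using that by (auto simp: separates_def)
  qed
qed

text \<open>If \<open>a\<close> were weakly left of \<open>b\<close>, the trapezoid on the left of
  \<open>a\<close> would lie strictly left of the one on the right of \<open>b\<close>, although
  these two meet.\<close>

lemma separating_lines_cross:
  assumes "separates a A A'" "separates b B B'"
    and "meets A B" "meets A B'" "meets A' B" "meets A' B'"
  shows "\<not> weakly_left_of a b" "\<not> weakly_left_of b a"
  using assms unfolding separates_def meets_def left_of_def weakly_left_of_def
  by (smt (verit))+

text \<open>Here \<open>b\<close> is left of \<open>a\<close> on L1 and right of it on L2, and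
  \<open>c\<close> the other way round. As \<open>B'\<close> avoids \<open>b\<close> and meets both
  \<open>A\<close> and \<open>A'\<close>, it has an endpoint left of \<open>a\<close> on L1 and one
  right of \<open>a\<close> on L2; for \<open>C'\<close> it is the opposite. Hence neither of
  \<open>B'\<close> and \<open>C'\<close> can be entirely left of the other.\<close>

lemma forcing_aux:
  assumes a: "separates a A A'" and b: "separates b B B'" and c: "separates c C C'"
    and meet: "meets A B'" "meets A' B'" "meets A C'" "meets A' C'"
    and "\<not> meets B' C'"
    and proper: "weakly_left_of (fst B') (snd B')" "weakly_left_of (fst C') (snd C')"
    and ab: "fst b < fst a" "snd a < snd b" and ac: "fst a < fst c" "snd c < snd a"
  shows False
proof -
  have reach: "(fst a < fst (snd X) \<or> snd a < snd (snd X)) \<and>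
      (fst (fst X) < fst a \<or> snd (fst X) < snd a)" if "meets A X" "meets A' X" for X
    using a that unfolding separates_def meets_def left_of_def by (smt (verit))
  have avoid: "left_of (snd B') b \<or> left_of b (fst B')" "left_of (snd C') c \<or> left_of c (fst C')"
    using b c by (auto simp: separates_def)
  show False
    using reach[OF meet(1,2)] reach[OF meet(3,4)] avoid \<open>\<not> meets B' C'\<close> proper ab ac
    unfolding meets_def left_of_def weakly_left_of_def by (smt (verit))
qed

text \<open>The line \<open>a\<close> crosses \<open>b\<close> and \<open>c\<close>.  Only the side parallelograms \<open>B'\<close> and \<open>C'\<close>
  are known to be disjoint: the separating lines \<open>b\<close> and \<open>c\<close> might cross a priori.\<close>

lemma slope_forcing:
  assumes a: "separates a A A'" and b: "separates b B B'" and c: "separates c C C'"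
    and meet: "meets A B" "meets A B'" "meets A' B" "meets A' B'"
      "meets A C" "meets A C'" "meets A' C" "meets A' C'"
    and disj: "\<not> meets B' C'"
    and proper: "weakly_left_of (fst B') (snd B')" "weakly_left_of (fst C') (snd C')"
  shows "slope a < slope b \<longleftrightarrow> slope a < slope c"
proof -
  note ab = separating_lines_cross[OF a b meet(1-4)]
  note ac = separating_lines_cross[OF a c meet(5-8)]
  have disj': "\<not> meets C' B'" using disj by (auto simp: meets_def)
  show ?thesis
    using forcing_aux[OF a b c meet(2,4,6,8) disj proper]
      forcing_aux[OF a c b meet(6,8,2,4) disj' proper(2,1)] ab ac
    by (smt (verit) not_weakly_left_imp_slope slope_def weakly_left_of_def)
qed

section \<open>The trapezoids of one group\<close>

text \<open>Offsets are in units of the chosen distance. Index 0 is the trapezoid of the group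
  itself, so that all seven vertices of a group are treated alike.\<close>

definition left_offset :: "nat \<Rightarrow> real" where
  "left_offset s = [0, - 1/2, - 3/4, - 7/8, - 1/2, 1/4, 3/8] ! s"

definition right_offset :: "nat \<Rightarrow> real" where
  "right_offset s = [0, 1/2, - 1/4, - 3/8, 1/2, 3/4, 7/8] ! s"

definition left_base :: "nat \<Rightarrow> 'a \<times> 'a \<Rightarrow> 'a" where
  "left_base s u = (if s \<le> 3 then fst u else snd u)"

definition right_base :: "nat \<Rightarrow> 'a \<times> 'a \<Rightarrow> 'a" where
  "right_base s u = (if s \<in> {1, 2, 3} then fst u else snd u)"

definition group_trapezoid :: "real \<Rightarrow> line \<times> line \<Rightarrow> nat \<Rightarrow> trapezoid" where
  "group_trapezoid e u s =
     (shift (left_offset s * e) (left_base s u), shift (right_offset s * e) (right_base s u))"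

text \<open>Only indices occur here, so any two systems of lines and distances agree on the order
  within a group.\<close>

definition group_before :: "nat \<Rightarrow> nat \<Rightarrow> bool" where
  "group_before s s' \<longleftrightarrow>
     (if s \<in> {1, 2, 3} then 4 \<le> s' \<or> right_offset s < left_offset s'
      else 4 \<le> s' \<and> right_offset s < left_offset s')"

lemma le_6_cases:
  "s \<le> 6 \<Longrightarrow> s = 0 \<or> s = 1 \<or> s = 2 \<or> s = 3 \<or> s = 4 \<or> s = 5 \<or> s = (6::nat)"
  by linarith

lemma offset_bounds:
  assumes "s \<le> 6"
  shows "\<bar>left_offset s\<bar> < 1" "\<bar>right_offset s\<bar> < 1" "s \<noteq> 0 \<Longrightarrow> left_offset s < right_offset s"
    "s \<in> {1, 2, 3} \<Longrightarrow> right_offset s \<le> 1/2" "s \<notin> {1, 2, 3} \<Longrightarrow> 0 \<le> right_offset s"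
    "s \<le> 3 \<Longrightarrow> left_offset s \<le> 0" "\<not> s \<le> 3 \<Longrightarrow> - 1/2 \<le> left_offset s"
  using le_6_cases[OF assms] by (auto simp: left_offset_def right_offset_def)

text \<open>Sides that are translates of the same line never coincide, so weak and strict comparison
  of them agree.\<close>

lemma right_offset_neq_left_offset:
  assumes "s \<le> 6" "s' \<le> 6" "s \<noteq> s'"
  shows "s \<in> {1, 2, 3} \<Longrightarrow> s' \<le> 3 \<Longrightarrow> right_offset s \<noteq> left_offset s'"
    "s \<notin> {1, 2, 3} \<Longrightarrow> \<not> s' \<le> 3 \<Longrightarrow> right_offset s \<noteq> left_offset s'"
  using le_6_cases[OF assms(1)] le_6_cases[OF assms(2)] assms(3)
  by (auto simp: left_offset_def right_offset_def)

lemma left_of_group_trapezoid: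
  assumes "left_of p q" "0 < e" "s \<le> 6"
  shows "left_of (fst (group_trapezoid e (p, q) s)) (snd (group_trapezoid e (p, q) s))"
proof (cases "s = 0")
  case True
  then show ?thesis using assms
    by (simp add: group_trapezoid_def left_base_def right_base_def shift_def
        left_offset_def right_offset_def)
next
  case False
  then have "left_offset s * e < right_offset s * e" using offset_bounds(3)[OF assms(3)] assms by simp
  moreover have "(s \<le> 3) = (s \<in> {1, 2, 3})" using False by auto
  ultimately show ?thesis
    by (auto simp: group_trapezoid_def left_base_def right_base_def shift_def left_of_def)
qed

text \<open>The weak form serves the open regions of the given trapezoids, where \<open>e\<close>
  may equal the gap between \<open>p\<close> and \<open>q\<close>; the strict form serves the
  parallelograms built from a layout.\<close>

lemma group_before_iff:
  assumes "left_of p q" "0 < e" "e \<le> fst q - fst p" "e \<le> snd q - snd p"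
    and s: "s \<le> 6" "s' \<le> 6" "s \<noteq> s'"
  shows "weakly_left_of (snd (group_trapezoid e (p, q) s)) (fst (group_trapezoid e (p, q) s'))
      \<longleftrightarrow> group_before s s'"
    and "e < fst q - fst p \<Longrightarrow> e < snd q - snd p \<Longrightarrow>
      left_of (snd (group_trapezoid e (p, q) s)) (fst (group_trapezoid e (p, q) s'))
      \<longleftrightarrow> group_before s s'"
proof -
  note bounds = offset_bounds[OF s(1)] offset_bounds[OF s(2)]
  have *: "(weakly_left_of (snd (group_trapezoid e (p, q) s)) (fst (group_trapezoid e (p, q) s'))
      \<longleftrightarrow> group_before s s') \<and> (e < fst q - fst p \<longrightarrow> e < snd q - snd p \<longrightarrow>
      (left_of (snd (group_trapezoid e (p, q) s)) (fst (group_trapezoid e (p, q) s'))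
      \<longleftrightarrow> group_before s s'))"
  proof (cases "s \<in> {1, 2, 3}"; cases "s' \<le> 3")
    assume c: "s \<in> {1, 2, 3}" "s' \<le> 3"
    have "right_offset s * e < left_offset s' * e \<longleftrightarrow> right_offset s < left_offset s'"
      "right_offset s * e \<le> left_offset s' * e \<longleftrightarrow> right_offset s < left_offset s'"
      using assms(2) right_offset_neq_left_offset(1)[OF s c] by (auto simp: mult_less_cancel_right_pos)
    then show ?thesis using c
      by (auto simp: group_before_def group_trapezoid_def left_base_def right_base_def shift_def
          weakly_left_of_def left_of_def)
  next
    assume c: "s \<notin> {1, 2, 3}" "\<not> s' \<le> 3"
    have "right_offset s * e < left_offset s' * e \<longleftrightarrow> right_offset s < left_offset s'"
      "right_offset s * e \<le> left_offset s' * e \<longleftrightarrow> right_offset s < left_offset s'"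
      using assms(2) right_offset_neq_left_offset(2)[OF s c] by (auto simp: mult_less_cancel_right_pos)
    then show ?thesis using c
      by (auto simp: group_before_def group_trapezoid_def left_base_def right_base_def shift_def
          weakly_left_of_def left_of_def)
  next
    assume c: "s \<in> {1, 2, 3}" "\<not> s' \<le> 3"
    \<comment> \<open>Both bounds are attained for \<open>s = 1\<close> and \<open>s' = 4\<close>:
      together these offsets use up exactly \<open>e\<close>.\<close>
    have "right_offset s * e \<le> 1/2 * e" "(- 1/2) * e \<le> left_offset s' * e"
      using bounds c assms(2) by (intro mult_right_mono; auto)+
    then have "right_offset s * e - left_offset s' * e \<le> e" by linarith
    moreover have "right_base s (p, q) = p" "left_base s' (p, q) = q" "group_before s s'"
      using c by (auto simp: group_before_def left_base_def right_base_def)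
    ultimately show ?thesis using assms
      by (simp add: group_trapezoid_def shift_def weakly_left_of_def left_of_def)
  next
    assume c: "s \<notin> {1, 2, 3}" "s' \<le> 3"
    have "0 \<le> right_offset s * e" "left_offset s' * e \<le> 0"
      using bounds c assms(2) by (auto simp: mult_nonpos_nonneg)
    moreover have "right_base s (p, q) = q" "left_base s' (p, q) = p" "\<not> group_before s s'"
      using c by (auto simp: group_before_def left_base_def right_base_def)
    ultimately show ?thesis using assms
      by (simp add: group_trapezoid_def shift_def weakly_left_of_def left_of_def)
  qed
  then show "weakly_left_of (snd (group_trapezoid e (p, q) s)) (fst (group_trapezoid e (p, q) s'))
      \<longleftrightarrow> group_before s s'"
    and "e < fst q - fst p \<Longrightarrow> e < snd q - snd p \<Longrightarrow>
      left_of (snd (group_trapezoid e (p, q) s)) (fst (group_trapezoid e (p, q) s'))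
      \<longleftrightarrow> group_before s s'"
    by blast+
qed

lemma scaled_abs_less:
  fixes c e :: real
  assumes "\<bar>c\<bar> < 1" "0 < e"
  shows "\<bar>c * e\<bar> < e"
  using assms by (simp add: abs_mult)

section \<open>The smallest distance\<close>

lemma finite_endpoints:
  assumes "finite (dom \<rho>)"
  shows "finite (endpoints1 \<rho>)" "finite (endpoints2 \<rho>)"
  using finite_ran[OF assms] by (auto simp: endpoints1_def endpoints2_def)

lemma finite_distances:
  fixes E :: "real set"
  assumes "finite E"
  shows "finite {dist x y | x y. x \<in> E \<and> y \<in> E \<and> x \<noteq> y}"
  by (rule finite_subset[of _ "(\<lambda>(x, y). dist x y) ` (E \<times> E)"]) (use assms in auto)

lemma min_distance_le:
  assumes "finite (dom \<rho>)"
  shows "x \<in> endpoints1 \<rho> \<Longrightarrow> y \<in> endpoints1 \<rho> \<Longrightarrow> x \<noteq> y \<Longrightarrow> min_distance \<rho> \<le> \<bar>x - y\<bar>"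
    and "x \<in> endpoints2 \<rho> \<Longrightarrow> y \<in> endpoints2 \<rho> \<Longrightarrow> x \<noteq> y \<Longrightarrow> min_distance \<rho> \<le> \<bar>x - y\<bar>"
  unfolding min_distance_def dist_real_def[symmetric]
  by (rule Min_le; use finite_endpoints[OF assms] in \<open>auto intro: finite_distances\<close>)+

lemma min_distance_pos:
  assumes "finite (dom \<rho>)" "x \<in> endpoints1 \<rho>" "y \<in> endpoints1 \<rho>" "x \<noteq> y"
  shows "0 < min_distance \<rho>"
  unfolding min_distance_def
  by (subst Min_gr_iff) (use assms finite_endpoints[OF assms(1)] in \<open>auto intro: finite_distances\<close>)

text \<open>The factor 2 allows both points to move by less than \<open>d\<close> without changing
  their order.\<close>

lemma finite_inj_separated:
  fixes f :: "'a \<Rightarrow> real"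
  assumes "finite A" "inj_on f A"
  obtains d where "0 < d" "\<And>p q. p \<in> A \<Longrightarrow> q \<in> A \<Longrightarrow> p \<noteq> q \<Longrightarrow> 2 * d < \<bar>f p - f q\<bar>"
proof -
  \<comment> \<open>The element 1 keeps \<open>D\<close> nonempty when \<open>A\<close> has at most
    one element.\<close>
  define D where "D = insert 1 ((\<lambda>(p, q). \<bar>f p - f q\<bar>) ` (A \<times> A - Id))"
  have fin: "finite D" using assms by (auto simp: D_def)
  have "0 < \<bar>f p - f q\<bar>" if "p \<in> A" "q \<in> A" "p \<noteq> q" for p q
    using inj_onD[OF assms(2) _ that(1,2)] that(3) by auto
  then have "\<forall>x\<in>D. 0 < x" unfolding D_def by force
  then have pos: "0 < Min D" using fin by (subst Min_gr_iff) (auto simp: D_def)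
  have "2 * (Min D / 3) < \<bar>f p - f q\<bar>" if "p \<in> A" "q \<in> A" "p \<noteq> q" for p q
  proof -
    have "\<bar>f p - f q\<bar> \<in> D" using that by (force simp: D_def)
    then have "Min D \<le> \<bar>f p - f q\<bar>" using fin by simp
    with pos show ?thesis by simp
  qed
  then show thesis using that[of "Min D / 3"] pos by simp
qed

section \<open>The line arrangement of a formula\<close>

text \<open>The other line of the group. The three groups of a clause follow one cyclic rule: the
  first line of a position is joined to the second line of the next position.\<close>

fun mate :: "line_id \<Rightarrow> line_id" where
  "mate (Ell1 (i, j)) = Ell2 (i, (j + 1) mod 3)"
| "mate (Ell2 (i, j)) = Ell1 (i, (j + 2) mod 3)"
| "mate (LinkU x y) = LinkV x y"
| "mate (LinkV x y) = LinkU x y"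

definition strictly_cross :: "line \<Rightarrow> line \<Rightarrow> bool" where
  "strictly_cross p q \<longleftrightarrow> \<not> weakly_left_of p q \<and> \<not> weakly_left_of q p"

lemma strictly_cross_commute: "strictly_cross p q \<longleftrightarrow> strictly_cross q p"
  by (auto simp: strictly_cross_def)

lemma left_of_trans: "left_of p q \<Longrightarrow> left_of q r \<Longrightarrow> left_of p r"
  by (auto simp: left_of_def)

lemma left_of_asym: "left_of p q \<Longrightarrow> \<not> left_of q p"
  by (auto simp: left_of_def)

lemma left_of_strictly_cross: "left_of p q \<Longrightarrow> \<not> strictly_cross p q"
  by (auto simp: left_of_def strictly_cross_def weakly_left_of_def)

locale formula_representation =
  fixes \<phi> :: formula
    and R :: "line_id \<Rightarrow> line"
    and ps :: "(line_id \<times> line_id) list"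
  assumes cnf: "monotone_3cnf \<phi>"
    and perm: "perm_representation \<phi> R"
    and enum: "enumerates_groups \<phi> R ps"
begin

declare split_paired_All [simp del] split_paired_Ex [simp del]

abbreviation "L \<equiv> line_ids \<phi> R"

lemma endpoints_distinct:
  assumes "p \<in> L" "q \<in> L" "p \<noteq> q"
  shows "fst (R p) \<noteq> fst (R q)" "snd (R p) \<noteq> snd (R q)"
  using perm assms by (auto simp: perm_representation_def inj_on_def)

lemma crosses_L_iff:
  assumes "p \<in> L" "q \<in> L" "p \<noteq> q"
  shows "crosses (R p) (R q) \<longleftrightarrow> \<not> left_of (R p) (R q) \<and> \<not> left_of (R q) (R p)"
  using crosses_iff endpoints_distinct[OF assms] by blast

lemma crosses_slope:
  assumes "p \<in> L" "q \<in> L" "p \<noteq> q" "crosses (R p) (R q)" "slope (R p) < slope (R q)"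
  shows "fst (R p) < fst (R q)" "snd (R q) < snd (R p)"
  using crosses_L_iff[OF assms(1-3)] endpoints_distinct[OF assms(1-3)] assms(4,5)
  by (auto simp: left_of_def slope_def)

lemma finite_L: "finite L"
proof -
  have fin: "finite (occs \<phi>)" by (simp add: occs_def)
  have "L \<subseteq> Ell1 ` occs \<phi> \<union> Ell2 ` occs \<phi> \<union> (\<lambda>(x, y). LinkU x y) ` (occs \<phi> \<times> occs \<phi>) \<union>
    (\<lambda>(x, y). LinkV x y) ` (occs \<phi> \<times> occs \<phi>)"
    by (auto simp: line_ids_def consecutive_def)
  then show ?thesis by (rule finite_subset) (use fin in auto)
qed

lemma Ell_in_L: "x \<in> occs \<phi> \<Longrightarrow> Ell1 x \<in> L" "x \<in> occs \<phi> \<Longrightarrow> Ell2 x \<in> L"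
  by (auto simp: line_ids_def)

lemma Link_in_L: "consecutive \<phi> R x y \<Longrightarrow> w \<in> {LinkU x y, LinkV x y} \<Longrightarrow> w \<in> L"
  by (auto simp: line_ids_def)

lemma L_cases:
  assumes "l \<in> L"
  obtains x where "x \<in> occs \<phi>" "l \<in> {Ell1 x, Ell2 x}"
  | x y where "consecutive \<phi> R x y" "l \<in> {LinkU x y, LinkV x y}"
  using assms by (auto simp: line_ids_def)

lemma consecutiveD:
  assumes "consecutive \<phi> R x y"
  shows "x \<in> occs \<phi>" "y \<in> occs \<phi>" "var \<phi> x = var \<phi> y" "occ_left R x y"
  using assms by (auto simp: consecutive_def)

lemma Ell_cross:
  assumes "x \<in> occs \<phi>"
  shows "fst (R (Ell1 x)) < fst (R (Ell2 x))" "snd (R (Ell2 x)) < snd (R (Ell1 x))"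
proof -
  have "crosses (R (Ell1 x)) (R (Ell2 x))" "slope (R (Ell1 x)) < slope (R (Ell2 x))"
    using perm assms theta_less_imp_slope_less by (auto simp: perm_representation_def)
  then show "fst (R (Ell1 x)) < fst (R (Ell2 x))" "snd (R (Ell2 x)) < snd (R (Ell1 x))"
    using crosses_slope[OF Ell_in_L(1)[OF assms] Ell_in_L(2)[OF assms]] by auto
qed

lemma occ_left_trans: "occ_left S x y \<Longrightarrow> occ_left S y z \<Longrightarrow> occ_left S x z"
  by (auto simp: occ_left_def left_of_def)

lemma occ_left_irrefl: "\<not> occ_left S x x"
  by (auto simp: occ_left_def left_of_def)

lemma occ_left_asym: "occ_left S x y \<Longrightarrow> \<not> occ_left S y x"
  using occ_left_trans occ_left_irrefl by blast

text \<open>Lines of different occurrences are comparable. All four comparisons agree, because a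
  line of \<open>y\<close> lying between the two lines of \<open>x\<close> would make these
  comparable although they cross, and likewise with \<open>x\<close> and \<open>y\<close>
  exchanged.\<close>

lemma occ_left_total:
  assumes "x \<in> occs \<phi>" "y \<in> occs \<phi>" "x \<noteq> y"
  shows "occ_left R x y \<or> occ_left R y x"
proof -
  have comp: "left_of (R p) (R q) \<or> left_of (R q) (R p)"
    if "p \<in> {Ell1 x, Ell2 x}" "q \<in> {Ell1 y, Ell2 y}" for p q
  proof -
    have "p \<in> L" "q \<in> L" "p \<noteq> q"
      using that Ell_in_L[OF assms(1)] Ell_in_L[OF assms(2)] assms(3) by auto
    moreover have "\<not> crosses (R p) (R q)"
      using perm assms that unfolding perm_representation_def by blast
    ultimately show ?thesis using crosses_L_iff by blast
  qed
  show ?thesis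
    using comp[of "Ell1 x" "Ell1 y"] comp[of "Ell1 x" "Ell2 y"] comp[of "Ell2 x" "Ell1 y"]
      comp[of "Ell2 x" "Ell2 y"] Ell_cross[OF assms(1)] Ell_cross[OF assms(2)]
    by (auto simp: occ_left_def left_of_def)
qed

text \<open>The smaller angle decides the direction of the crossings with \<open>Ell1 x\<close> and
  \<open>Ell1 y\<close>. Then \<open>w\<close> is right of \<open>Ell1 y\<close>, hence of
  \<open>Ell2 x\<close>, on L1, and left of \<open>Ell1 x\<close>, hence of \<open>Ell2 y\<close>,
  on L2; as \<open>w\<close> crosses neither \<open>Ell2\<close> line, one endpoint settles the
  order.\<close>

lemma Link_position:
  assumes c: "consecutive \<phi> R x y" and w: "w \<in> {LinkU x y, LinkV x y}"
  shows "left_of (R (Ell2 x)) (R w)" "left_of (R w) (R (Ell2 y))"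
    "fst (R (Ell1 x)) < fst (R w)" "snd (R w) < snd (R (Ell1 x))"
    "fst (R (Ell1 y)) < fst (R w)" "snd (R w) < snd (R (Ell1 y))"
proof -
  note xy = consecutiveD[OF c]
  have ne: "x \<noteq> y" using xy(4) occ_left_irrefl by blast
  have wL: "w \<in> L" using Link_in_L[OF c w] .
  have "theta (R w) < theta (R (Ell1 x))" "theta (R w) < theta (R (Ell1 y))"
    using perm c w unfolding perm_representation_def by (metis insertE singletonD)+
  then have sl: "slope (R (Ell1 x)) < slope (R w)" "slope (R (Ell1 y)) < slope (R w)"
    using theta_less_imp_slope_less by auto
  have cr: "crosses (R w) (R l) \<longleftrightarrow> l \<in> {Ell1 x, Ell1 y}" if "l \<in> L" "l \<noteq> w" for l
    using perm c w that unfolding perm_representation_def by blast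
  have cross: "crosses (R (Ell1 x)) (R w)" "crosses (R (Ell1 y)) (R w)"
    using cr[of "Ell1 x"] cr[of "Ell1 y"] w Ell_in_L(1)[OF xy(1)] Ell_in_L(1)[OF xy(2)] crosses_commute by auto
  have neq: "Ell1 z \<noteq> w" "Ell2 z \<noteq> w" for z using w by auto
  show 1: "fst (R (Ell1 x)) < fst (R w)" "snd (R w) < snd (R (Ell1 x))"
    using crosses_slope[OF Ell_in_L(1)[OF xy(1)] wL neq(1) cross(1) sl(1)] by auto
  show 2: "fst (R (Ell1 y)) < fst (R w)" "snd (R w) < snd (R (Ell1 y))"
    using crosses_slope[OF Ell_in_L(1)[OF xy(2)] wL neq(1) cross(2) sl(2)] by auto
  have nc: "\<not> crosses (R w) (R (Ell2 x))" "\<not> crosses (R w) (R (Ell2 y))"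
    using cr[of "Ell2 x"] cr[of "Ell2 y"] neq Ell_in_L(2)[OF xy(1)] Ell_in_L(2)[OF xy(2)] by auto
  show "left_of (R (Ell2 x)) (R w)"
    using nc(1) crosses_L_iff[OF wL Ell_in_L(2)[OF xy(1)] neq(2)[symmetric]] xy(4) 2
    by (auto simp: occ_left_def left_of_def)
  show "left_of (R w) (R (Ell2 y))"
    using nc(2) crosses_L_iff[OF wL Ell_in_L(2)[OF xy(2)] neq(2)[symmetric]] xy(4) 1
    by (auto simp: occ_left_def left_of_def)
qed

lemma Link_comparable:
  assumes c: "consecutive \<phi> R x y"
  shows "left_of (R (LinkU x y)) (R (LinkV x y)) \<or> left_of (R (LinkV x y)) (R (LinkU x y))"
proof -
  have "LinkU x y \<in> L" "LinkV x y \<in> L" using Link_in_L[OF c] by auto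
  moreover from this have "\<not> crosses (R (LinkU x y)) (R (LinkV x y))"
    using perm c unfolding perm_representation_def by blast
  ultimately show ?thesis using crosses_L_iff by blast
qed

lemma var_less_occ_left:
  assumes "x \<in> occs \<phi>" "y \<in> occs \<phi>" "var \<phi> x < var \<phi> y"
  shows "occ_left R x y"
  using perm assms by (simp add: perm_representation_def)

text \<open>The definition of \<open>consecutive\<close> excludes intermediate occurrences of the
  same variable; those of other variables lie to one side because variables are arranged in
  increasing order.\<close>

lemma consecutive_no_between:
  assumes c: "consecutive \<phi> R x y" and z: "z \<in> occs \<phi>"
  shows "occ_left R z x \<or> z = x \<or> z = y \<or> occ_left R y z"
proof (rule ccontr)
  assume "\<not> ?thesis"
  note xy = consecutiveD[OF c]
  from \<open>\<not> ?thesis\<close> have b: "occ_left R x z" "occ_left R z y"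
    using occ_left_total z xy by blast+
  have "var \<phi> z \<noteq> var \<phi> x" using c b z by (auto simp: consecutive_def)
  then consider "var \<phi> z < var \<phi> x" | "var \<phi> y < var \<phi> z" using xy by linarith
  then have "occ_left R z x \<or> occ_left R y z"
    using var_less_occ_left[OF z xy(1)] var_less_occ_left[OF xy(2) z] by cases simp_all
  with \<open>\<not> ?thesis\<close> show False by blast
qed

text \<open>Distinct consecutive pairs follow one another and share at most an end: no occurrence
  lies inside a pair, and pairs with the same left occurrence coincide.\<close>

lemma consecutive_unique:
  assumes c: "consecutive \<phi> R x y" "consecutive \<phi> R x' y'" and "(x, y) \<noteq> (x', y')"
  shows "x' = y \<or> occ_left R y x' \<or> x = y' \<or> occ_left R y' x"
proof -
  note d = consecutiveD[OF c(1)] consecutiveD[OF c(2)]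
  consider "occ_left R x' x" | "x' = x" | "x' = y \<or> occ_left R y x'"
    using consecutive_no_between[OF c(1) d(5)] by blast
  then show ?thesis
  proof cases
    case 1
    then show ?thesis
      using consecutive_no_between[OF c(2) d(1)] occ_left_asym occ_left_irrefl by blast
  next
    case 2
    then have "y = y'"
      using consecutive_no_between[OF c(1) d(6)] consecutive_no_between[OF c(2) d(2)] d
        occ_left_asym occ_left_irrefl by metis
    with 2 assms show ?thesis by simp
  qed auto
qed

text \<open>The properties of a line system that determine the left-to-right relation between all of
  its lines; it says nothing about which of two crossing lines is steeper.\<close>

definition arrangement :: "(line_id \<Rightarrow> line) \<Rightarrow> bool" where
  "arrangement S \<longleftrightarrow>
     (\<forall>x\<in>occs \<phi>. strictly_cross (S (Ell1 x)) (S (Ell2 x))) \<and>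
     (\<forall>x\<in>occs \<phi>. \<forall>y\<in>occs \<phi>. occ_left R x y \<longrightarrow> occ_left S x y) \<and>
     (\<forall>x y. consecutive \<phi> R x y \<longrightarrow>
        (\<forall>w\<in>{LinkU x y, LinkV x y}.
           left_of (S (Ell2 x)) (S w) \<and> left_of (S w) (S (Ell2 y)) \<and>
           strictly_cross (S (Ell1 x)) (S w) \<and> strictly_cross (S (Ell1 y)) (S w)) \<and>
        (if left_of (R (LinkU x y)) (R (LinkV x y))
         then left_of (S (LinkU x y)) (S (LinkV x y))
         else left_of (S (LinkV x y)) (S (LinkU x y))))"

lemma arrangement_R: "arrangement R"
  unfolding arrangement_def
proof (intro conjI ballI allI impI)
  fix x assume "x \<in> occs \<phi>"
  then show "strictly_cross (R (Ell1 x)) (R (Ell2 x))"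
    using Ell_cross by (auto simp: strictly_cross_def weakly_left_of_def not_le)
next
  fix x y w assume "consecutive \<phi> R x y" "w \<in> {LinkU x y, LinkV x y}"
  note Link_position[OF this]
  then show "left_of (R (Ell2 x)) (R w)" "left_of (R w) (R (Ell2 y))"
    "strictly_cross (R (Ell1 x)) (R w)" "strictly_cross (R (Ell1 y)) (R w)"
    by (auto simp: strictly_cross_def weakly_left_of_def not_le)
next
  fix x y assume "consecutive \<phi> R x y"
  then show "if left_of (R (LinkU x y)) (R (LinkV x y))
         then left_of (R (LinkU x y)) (R (LinkV x y))
         else left_of (R (LinkV x y)) (R (LinkU x y))"
    using Link_comparable[of x y] by auto
qed auto

section \<open>Relations valid in every arrangement\<close>

definition always_left :: "line_id \<Rightarrow> line_id \<Rightarrow> bool" where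
  "always_left p q \<longleftrightarrow> (\<forall>S. arrangement S \<longrightarrow> left_of (S p) (S q))"

definition always_cross :: "line_id \<Rightarrow> line_id \<Rightarrow> bool" where
  "always_cross p q \<longleftrightarrow> (\<forall>S. arrangement S \<longrightarrow> strictly_cross (S p) (S q))"

lemma always_left_trans: "always_left p q \<Longrightarrow> always_left q r \<Longrightarrow> always_left p r"
  unfolding always_left_def using left_of_trans by blast

lemma always_cross_commute: "always_cross p q \<longleftrightarrow> always_cross q p"
  unfolding always_cross_def using strictly_cross_commute by blast

lemma always_left_Ell:
  assumes "occ_left R x y" "x \<in> occs \<phi>" "y \<in> occs \<phi>" "p \<in> {Ell1 x, Ell2 x}" "q \<in> {Ell1 y, Ell2 y}"
  shows "always_left p q"
  unfolding always_left_def
proof (intro allI impI)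
  fix S assume "arrangement S"
  then have "occ_left S x y" using assms unfolding arrangement_def by blast
  then show "left_of (S p) (S q)" using assms unfolding occ_left_def by blast
qed

lemma always_cross_Ell: "x \<in> occs \<phi> \<Longrightarrow> always_cross (Ell1 x) (Ell2 x)"
  by (auto simp: always_cross_def arrangement_def)

lemma always_Link:
  assumes "consecutive \<phi> R x y" "w \<in> {LinkU x y, LinkV x y}"
  shows "always_left (Ell2 x) w" "always_left w (Ell2 y)"
    "always_cross (Ell1 x) w" "always_cross (Ell1 y) w"
  using assms unfolding always_left_def always_cross_def arrangement_def by blast+

text \<open>The lines \<open>Ell2 x\<close> and \<open>Ell2 y\<close> act as walls: the link lies
  between them, and every occurrence other than \<open>x\<close> and \<open>y\<close> lies beyond
  one of them.\<close>

lemma Ell_Link_trichotomy: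
  assumes z: "z \<in> occs \<phi>" "p \<in> {Ell1 z, Ell2 z}"
    and c: "consecutive \<phi> R x y" "w \<in> {LinkU x y, LinkV x y}"
  shows "always_left p w \<or> always_left w p \<or> always_cross p w"
proof -
  note xy = consecutiveD[OF c(1)]
  consider "occ_left R z x" | "z = x" | "z = y" | "occ_left R y z"
    using consecutive_no_between[OF c(1) z(1)] by blast
  then show ?thesis
  proof cases
    case 1
    then have "always_left p (Ell2 x)" using always_left_Ell z xy by blast
    then show ?thesis using always_left_trans always_Link(1)[OF c] by blast
  next
    case 4
    then have "always_left (Ell2 y) p" using always_left_Ell z xy by blast
    then show ?thesis using always_left_trans always_Link(2)[OF c] by blast
  qed (use z always_Link[OF c] in blast)+
qed

lemma Link_Link_always_left:
  assumes c: "consecutive \<phi> R x y" "w \<in> {LinkU x y, LinkV x y}"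
    and c': "consecutive \<phi> R x' y'" "w' \<in> {LinkU x' y', LinkV x' y'}"
    and "x' = y \<or> occ_left R y x'"
  shows "always_left w w'"
proof -
  have "x' = y \<or> always_left (Ell2 y) (Ell2 x')"
    using assms(5) always_left_Ell consecutiveD[OF c(1)] consecutiveD[OF c'(1)] by blast
  then show ?thesis
    using always_Link(2)[OF c] always_Link(1)[OF c'] always_left_trans by blast
qed

text \<open>The relation of any two lines is fixed by the combinatorics alone, so it can be
  transferred from \<open>R\<close> to another arrangement.\<close>

lemma L_trichotomy:
  assumes "p \<in> L" "q \<in> L" "p \<noteq> q"
  shows "always_left p q \<or> always_left q p \<or> always_cross p q"
  using assms(1)
proof (cases rule: L_cases)
  case p: (1 x)
  show ?thesis
    using assms(2)
  proof (cases rule: L_cases)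
    case q: (1 y)
    show ?thesis
    proof (cases "x = y")
      case True
      moreover have "always_cross (Ell1 x) (Ell2 x)" "always_cross (Ell2 x) (Ell1 x)"
        using always_cross_Ell[OF p(1)] always_cross_commute by blast+
      ultimately show ?thesis using p(2) q(2) assms(3) by auto
    next
      case False
      then show ?thesis using occ_left_total always_left_Ell p q by blast
    qed
  next
    case (2 y z)
    then show ?thesis using Ell_Link_trichotomy p by blast
  qed
next
  case p: (2 x y)
  show ?thesis
    using assms(2)
  proof (cases rule: L_cases)
    case (1 z)
    then show ?thesis using Ell_Link_trichotomy p always_cross_commute by blast
  next
    case q: (2 x' y')
    show ?thesis
    proof (cases "(x, y) = (x', y')")
      case True
      \<comment> \<open>The last clause of \<open>arrangement\<close> copies the order of the two
        links from \<open>R\<close>.\<close>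
      have "always_left (LinkU x y) (LinkV x y) \<or> always_left (LinkV x y) (LinkU x y)"
        using p(1) unfolding always_left_def arrangement_def by metis
      then show ?thesis using p q True assms(3) by auto
    next
      case False
      then show ?thesis
        using consecutive_unique[OF p(1) q(1)] Link_Link_always_left[OF p q]
          Link_Link_always_left[OF q p] by blast
    qed
  qed
qed

lemma arrangement_left_of_iff:
  assumes "arrangement S" "p \<in> L" "q \<in> L"
  shows "left_of (S p) (S q) \<longleftrightarrow> left_of (R p) (R q)"
proof (cases "p = q")
  case True
  then show ?thesis by (auto simp: left_of_def)
next
  case False
  then show ?thesis
    using L_trichotomy[OF assms(2,3)] assms(1) arrangement_R left_of_asym left_of_strictly_cross
      strictly_cross_commute unfolding always_left_def always_cross_def by metis
qed

lemma arrangement_endpoints_distinct: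
  assumes "arrangement S" "p \<in> L" "q \<in> L" "p \<noteq> q"
  shows "fst (S p) \<noteq> fst (S q)" "snd (S p) \<noteq> snd (S q)"
  using L_trichotomy[OF assms(2-)] assms(1) unfolding always_left_def always_cross_def
  by (fastforce simp: left_of_def strictly_cross_def weakly_left_of_def)+

section \<open>Mates and the enumeration of the groups\<close>

lemma mate_in_L: "l \<in> L \<Longrightarrow> mate l \<in> L"
  by (auto simp: line_ids_def occs_def)

lemma mate_mate: "l \<in> L \<Longrightarrow> mate (mate l) = l"
  by (auto simp: line_ids_def occs_def mod_simps)

lemma mate_left_of:
  assumes "l \<in> L"
  shows "left_of (R l) (R (mate l)) \<or> left_of (R (mate l)) (R l)"
  using assms
proof (cases rule: L_cases)
  case (1 x)
  obtain i j where x: "x = (i, j)" by fastforce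
  define y where "y = (if l = Ell1 x then (i, (j + 1) mod 3) else (i, (j + 2) mod 3))"
  have y: "y \<in> occs \<phi>" "y \<noteq> x" "mate l \<in> {Ell1 y, Ell2 y}"
    using 1 x by (auto simp: y_def occs_def) presburger+
  show ?thesis using occ_left_total[OF 1(1) y(1)] y 1 unfolding occ_left_def by blast
next
  case (2 x y)
  then show ?thesis using Link_comparable[of x y] by auto
qed

lemma line_groups_iff: "{p, q} \<in> line_groups \<phi> R \<longleftrightarrow> p \<in> L \<and> q = mate p"
proof
  assume "{p, q} \<in> line_groups \<phi> R"
  then show "p \<in> L \<and> q = mate p"
    by (auto simp: line_groups_def line_ids_def occs_def doubleton_eq_iff)
next
  assume *: "p \<in> L \<and> q = mate p"
  then have "p \<in> L" by blast
  then show "{p, q} \<in> line_groups \<phi> R"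
  proof (cases rule: L_cases)
    case (1 x)
    obtain i j where x: "x = (i, j)" by fastforce
    have "i < length \<phi>" "j = 0 \<or> j = 1 \<or> j = 2" using 1 x by (auto simp: occs_def)
    then show ?thesis using 1 x *
      by (auto simp: line_groups_def doubleton_eq_iff numeral_2_eq_2)
  next
    case (2 x y)
    then show ?thesis using * by (auto simp: line_groups_def insert_commute)
  qed
qed

lemma set_ps: "set ps = {(p, mate p) | p. p \<in> L \<and> left_of (R p) (R (mate p))}"
  using enum by (auto simp: enumerates_groups_def line_groups_iff)

lemma ps_nth:
  assumes "t < length ps"
  shows "fst (ps ! t) \<in> L" "snd (ps ! t) = mate (fst (ps ! t))" "snd (ps ! t) \<in> L"
    "left_of (R (fst (ps ! t))) (R (snd (ps ! t)))"
  using nth_mem[OF assms] mate_in_L[of "fst (ps ! t)"] unfolding set_ps by auto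

definition group_lines :: "nat \<Rightarrow> line_id set" where
  "group_lines t = {fst (ps ! t), snd (ps ! t)}"

lemma base_in_group_lines:
  "left_base s (ps ! t) \<in> group_lines t" "right_base s (ps ! t) \<in> group_lines t"
  by (auto simp: group_lines_def left_base_def right_base_def)

lemma group_lines_subset: "t < length ps \<Longrightarrow> group_lines t \<subseteq> L"
  using ps_nth by (auto simp: group_lines_def)

lemma ex_group:
  assumes "l \<in> L"
  shows "\<exists>t<length ps. l \<in> group_lines t"
proof -
  have "(l, mate l) \<in> set ps \<or> (mate l, l) \<in> set ps"
    using mate_left_of[OF assms] assms mate_in_L mate_mate unfolding set_ps by force
  then show ?thesis by (fastforce simp: in_set_conv_nth group_lines_def)
qed

lemma group_lines_eq:
  assumes "t < length ps" "l \<in> group_lines t"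
  shows "group_lines t = {l, mate l}"
  using assms ps_nth[OF assms(1)] mate_mate[OF ps_nth(1)[OF assms(1)]] by (auto simp: group_lines_def)

text \<open>Groups sharing a line have the same two lines, and \<open>left_of\<close> fixes the
  order in which these are listed.\<close>

lemma group_unique:
  assumes "t < length ps" "t' < length ps" "l \<in> group_lines t" "l \<in> group_lines t'"
  shows "t = t'"
proof -
  have "group_lines t = group_lines t'"
    using group_lines_eq assms by metis
  then have "ps ! t = ps ! t'"
    using ps_nth(4)[OF assms(1)] left_of_asym[OF ps_nth(4)[OF assms(2)]]
    by (auto simp: group_lines_def doubleton_eq_iff prod_eq_iff)
  then show ?thesis
    using enum assms by (auto simp: enumerates_groups_def nth_eq_iff_index_eq)
qed

section \<open>Adjacency in the graph\<close>

definition eps :: "nat \<Rightarrow> real" where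
  "eps t = min_distance (R_H_upto R ps t)"

text \<open>Step \<open>t\<close> chooses \<open>eps t\<close>, and later steps leave its
  parallelograms unchanged. For \<open>s = 0\<close> both offsets vanish, so \<open>eps t\<close>
  may appear in the formula even for groups not yet processed.\<close>

lemma R_H_upto_eq:
  "k \<le> length ps \<Longrightarrow> R_H_upto R ps k = (\<lambda>(t, s).
     if t < length ps \<and> s = 0 \<or> t < k \<and> s \<in> {1..6}
     then Some (group_trapezoid (eps t) (map_prod R R (ps ! t)) s) else None)"
proof (induction k)
  case 0
  show ?case
    by (auto simp: R_G_def fun_eq_iff group_trapezoid_def left_base_def right_base_def left_offset_def
        right_offset_def shift_def prod_eq_iff)
next
  case (Suc k)
  then have IH: "R_H_upto R ps k (t, s) = (if t < length ps \<and> s = 0 \<or> t < k \<and> s \<in> {1..6}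
     then Some (group_trapezoid (eps t) (map_prod R R (ps ! t)) s) else None)" for t s
    by simp
  show ?case
  proof (rule ext, clarify)
    fix t s
    show "R_H_upto R ps (Suc k) (t, s) =
      (if t < length ps \<and> s = 0 \<or> t < Suc k \<and> s \<in> {1..6}
       then Some (group_trapezoid (eps t) (map_prod R R (ps ! t)) s) else None)"
    proof (cases "t = k \<and> s \<in> {1..6}")
      case True
      then have "t = k" "s = 1 \<or> s = 2 \<or> s = 3 \<or> s = 4 \<or> s = 5 \<or> s = 6" by auto
      then show ?thesis
        by (elim disjE) (simp_all add: add_six_def Let_def eps_def[symmetric] group_trapezoid_def
            left_base_def right_base_def left_offset_def right_offset_def)
    next
      case False
      then have "R_H_upto R ps (Suc k) (t, s) = R_H_upto R ps k (t, s)"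
        by (auto simp: add_six_def Let_def)
      then show ?thesis using IH False by auto
    qed
  qed
qed

lemma dom_R_H_upto:
  assumes "k \<le> length ps"
  shows "dom (R_H_upto R ps k) = {..<length ps} \<times> {0} \<union> {..<k} \<times> {1..6}"
  unfolding R_H_upto_eq[OF assms] by (auto split: if_splits)

lemma finite_dom_R_H_upto: "k \<le> length ps \<Longrightarrow> finite (dom (R_H_upto R ps k))"
  by (simp add: dom_R_H_upto)

definition H_trapezoid :: "vertex \<Rightarrow> trapezoid" where
  "H_trapezoid v = group_trapezoid (eps (fst v)) (map_prod R R (ps ! fst v)) (snd v)"

lemma base_map_prod:
  "left_base s (map_prod f f u) = f (left_base s u)"
  "right_base s (map_prod f f u) = f (right_base s u)"
  by (auto simp: left_base_def right_base_def)

lemma endpoints_mem: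
  assumes "k \<le> length ps" "t < length ps" "s = 0 \<or> t < k \<and> s \<le> 6"
  shows "fst (R (left_base s (ps ! t))) + left_offset s * eps t \<in> endpoints1 (R_H_upto R ps k)"
    "fst (R (right_base s (ps ! t))) + right_offset s * eps t \<in> endpoints1 (R_H_upto R ps k)"
    "snd (R (left_base s (ps ! t))) + left_offset s * eps t \<in> endpoints2 (R_H_upto R ps k)"
    "snd (R (right_base s (ps ! t))) + right_offset s * eps t \<in> endpoints2 (R_H_upto R ps k)"
proof -
  have "R_H_upto R ps k (t, s) = Some (H_trapezoid (t, s))"
    using assms by (auto simp: R_H_upto_eq H_trapezoid_def)
  then have "H_trapezoid (t, s) \<in> ran (R_H_upto R ps k)" by (rule ranI)
  then show "fst (R (left_base s (ps ! t))) + left_offset s * eps t \<in> endpoints1 (R_H_upto R ps k)"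
    "fst (R (right_base s (ps ! t))) + right_offset s * eps t \<in> endpoints1 (R_H_upto R ps k)"
    "snd (R (left_base s (ps ! t))) + left_offset s * eps t \<in> endpoints2 (R_H_upto R ps k)"
    "snd (R (right_base s (ps ! t))) + right_offset s * eps t \<in> endpoints2 (R_H_upto R ps k)"
    unfolding endpoints1_def endpoints2_def
    by (force simp: H_trapezoid_def group_trapezoid_def shift_def base_map_prod)+
qed

lemma line_endpoints_mem:
  assumes "k \<le> length ps" "t < length ps" "l \<in> group_lines t"
  shows "fst (R l) \<in> endpoints1 (R_H_upto R ps k)" "snd (R l) \<in> endpoints2 (R_H_upto R ps k)"
  using endpoints_mem[OF assms(1,2), of 0] assms(3)
  by (auto simp: group_lines_def left_base_def right_base_def left_offset_def right_offset_def)

lemma eps_pos: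
  assumes "t < length ps"
  shows "0 < eps t"
proof -
  have t: "t \<le> length ps" using assms by simp
  show ?thesis
    unfolding eps_def
    by (rule min_distance_pos[OF finite_dom_R_H_upto[OF t]
          line_endpoints_mem(1)[OF t assms, of "fst (ps ! t)"]
          line_endpoints_mem(1)[OF t assms, of "snd (ps ! t)"]])
      (use ps_nth(4)[OF assms] in \<open>auto simp: group_lines_def left_of_def\<close>)
qed

lemma eps_le_line_distance:
  assumes "k < length ps" "t < length ps" "t' < length ps" "l \<in> group_lines t"
    "l' \<in> group_lines t'" "l \<noteq> l'"
  shows "eps k \<le> \<bar>fst (R l) - fst (R l')\<bar>" "eps k \<le> \<bar>snd (R l) - snd (R l')\<bar>"
proof -
  have k: "k \<le> length ps" using assms by simp
  have "l \<in> L" "l' \<in> L" using assms group_lines_subset by auto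
  note d = endpoints_distinct[OF this assms(6)]
  show "eps k \<le> \<bar>fst (R l) - fst (R l')\<bar>" "eps k \<le> \<bar>snd (R l) - snd (R l')\<bar>"
    unfolding eps_def
    using min_distance_le[OF finite_dom_R_H_upto[OF k]] d
      line_endpoints_mem[OF k assms(2,4)] line_endpoints_mem[OF k assms(3,5)] by auto
qed

text \<open>Each new distance is at most the gaps present when it is chosen, so the translates of
  lines of different groups are ordered as the lines themselves.\<close>

lemma translates_ordered:
  assumes t: "t < length ps" "t' < length ps" "t \<noteq> t'" and s: "s \<le> 6" "s' \<le> 6"
  shows "weakly_left_of (snd (H_trapezoid (t, s))) (fst (H_trapezoid (t', s'))) \<longleftrightarrow>
    left_of (R (right_base s (ps ! t))) (R (left_base s' (ps ! t')))"
proof -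
  define l where "l = right_base s (ps ! t)"
  define l' where "l' = left_base s' (ps ! t')"
  have l: "l \<in> group_lines t" "l' \<in> group_lines t'"
    using base_in_group_lines by (auto simp: l_def l'_def)
  have ne: "l \<noteq> l'" using group_unique[OF t(1,2)] l t(3) by blast
  have pos: "0 < eps t" "0 < eps t'" using eps_pos t by auto
  define c where "c = right_offset s * eps t"
  define c' where "c' = left_offset s' * eps t'"
  have c: "\<bar>c\<bar> < eps t" "\<bar>c'\<bar> < eps t'"
    unfolding c_def c'_def using scaled_abs_less offset_bounds s pos by auto
  note base = eps_le_line_distance[OF t(1) t(1,2) l ne] eps_le_line_distance[OF t(2) t(1,2) l ne]
  have le: "t \<le> length ps" "t' \<le> length ps" using t by auto
  \<comment> \<open>The translate made in the earlier step is already an endpoint when the later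
    distance is chosen, and it differs from the endpoint of \<open>l'\<close> because
    \<open>c\<close> is smaller than the distance of the lines.\<close>
  have far: "eps t' \<le> \<bar>fst (R l) + c - fst (R l')\<bar>" "eps t' \<le> \<bar>snd (R l) + c - snd (R l')\<bar>" if "t < t'"
  proof -
    note m = endpoints_mem(2,4)[OF le(2) t(1) disjI2[OF conjI[OF that s(1)]], folded l_def c_def]
    have "fst (R l) + c \<noteq> fst (R l')" "snd (R l) + c \<noteq> snd (R l')"
      using base c by auto
    then show "eps t' \<le> \<bar>fst (R l) + c - fst (R l')\<bar>" "eps t' \<le> \<bar>snd (R l) + c - snd (R l')\<bar>"
      unfolding eps_def using min_distance_le[OF finite_dom_R_H_upto[OF le(2)]] m
        line_endpoints_mem[OF le(2) t(2) l(2)] by auto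
  qed
  have far': "eps t \<le> \<bar>fst (R l') + c' - fst (R l)\<bar>" "eps t \<le> \<bar>snd (R l') + c' - snd (R l)\<bar>" if "t' < t"
  proof -
    note m = endpoints_mem(1,3)[OF le(1) t(2) disjI2[OF conjI[OF that s(2)]], folded l'_def c'_def]
    have "fst (R l') + c' \<noteq> fst (R l)" "snd (R l') + c' \<noteq> snd (R l)"
      using base c by auto
    then show "eps t \<le> \<bar>fst (R l') + c' - fst (R l)\<bar>" "eps t \<le> \<bar>snd (R l') + c' - snd (R l)\<bar>"
      unfolding eps_def using min_distance_le[OF finite_dom_R_H_upto[OF le(1)]] m
        line_endpoints_mem[OF le(1) t(1) l(1)] by auto
  qed
  have "fst (R l) + c \<le> fst (R l') + c' \<longleftrightarrow> fst (R l) < fst (R l')"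
    "snd (R l) + c \<le> snd (R l') + c' \<longleftrightarrow> snd (R l) < snd (R l')"
    using t(3) far far' base c by (cases "t < t'"; auto)+
  then show ?thesis
    by (simp add: H_trapezoid_def group_trapezoid_def shift_def base_map_prod l_def[symmetric]
        l'_def[symmetric] c_def[symmetric] c'_def[symmetric] weakly_left_of_def left_of_def)
qed

section \<open>Combinatorial description of adjacency\<close>

definition before :: "vertex \<Rightarrow> vertex \<Rightarrow> bool" where
  "before u v \<longleftrightarrow> (if fst u = fst v then group_before (snd u) (snd v)
     else left_of (R (right_base (snd u) (ps ! fst u))) (R (left_base (snd v) (ps ! fst v))))"

lemma fst_H_graph: "fst (H_graph R ps) = {..<length ps} \<times> {..6}"
proof -
  have "{..6::nat} = insert 0 {1..6}" by auto
  then show ?thesis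
    by (auto simp: H_graph_def trapezoid_graph_def dom_R_H_upto)
qed

lemma finite_vertices: "finite (fst (H_graph R ps))"
  by (simp add: fst_H_graph)

lemma H_trapezoid_proper:
  assumes "v \<in> fst (H_graph R ps)"
  shows "left_of (fst (H_trapezoid v)) (snd (H_trapezoid v))"
proof -
  have "fst v < length ps" "snd v \<le> 6" using assms by (auto simp: fst_H_graph)
  then show ?thesis
    using left_of_group_trapezoid[OF ps_nth(4) eps_pos, of "fst v" "fst v" "snd v"]
    by (simp add: H_trapezoid_def map_prod_def case_prod_beta)
qed

lemma H_trapezoid_before:
  assumes "u \<in> fst (H_graph R ps)" "v \<in> fst (H_graph R ps)" "u \<noteq> v"
  shows "weakly_left_of (snd (H_trapezoid u)) (fst (H_trapezoid v)) \<longleftrightarrow> before u v"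
proof -
  obtain t s t' s' where uv: "u = (t, s)" "v = (t', s')" by fastforce
  have b: "t < length ps" "t' < length ps" "s \<le> 6" "s' \<le> 6"
    using assms by (auto simp: uv fst_H_graph)
  show ?thesis
  proof (cases "t = t'")
    case True
    define p where "p = fst (ps ! t)"
    define q where "q = snd (ps ! t)"
    have pq: "left_of (R p) (R q)" using ps_nth(4)[OF b(1)] by (simp add: p_def q_def)
    have "p \<noteq> q" using pq by (auto simp: left_of_def)
    have pl: "p \<in> group_lines t" "q \<in> group_lines t" by (auto simp: p_def q_def group_lines_def)
    have "eps t \<le> fst (R q) - fst (R p)" "eps t \<le> snd (R q) - snd (R p)"
      using eps_le_line_distance[OF b(1) b(1) b(1) pl \<open>p \<noteq> q\<close>] pq by (auto simp: left_of_def)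
    from group_before_iff(1)[OF pq eps_pos[OF b(1)] this b(3,4)] True assms(3)
    show ?thesis
      by (simp add: before_def H_trapezoid_def uv map_prod_def case_prod_beta p_def q_def)
  next
    case False
    then show ?thesis using translates_ordered[OF b(1,2) False b(3,4)] by (simp add: before_def uv)
  qed
qed

text \<open>Adjacency depends on \<open>R\<close> only through the relation \<open>left_of\<close>
  between its lines; both directions of the theorem rest on this.\<close>

lemma H_edge_iff:
  assumes "u \<in> fst (H_graph R ps)" "v \<in> fst (H_graph R ps)" "u \<noteq> v"
  shows "{u, v} \<in> snd (H_graph R ps) \<longleftrightarrow> \<not> before u v \<and> \<not> before v u"
proof -
  have val: "the (R_H_upto R ps (length ps) w) = H_trapezoid w" if "w \<in> fst (H_graph R ps)" for w
    using that by (cases w) (auto simp: R_H_upto_eq fst_H_graph H_trapezoid_def)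
  have dom: "fst (H_graph R ps) = dom (R_H_upto R ps (length ps))"
    by (simp add: H_graph_def trapezoid_graph_def)
  have "{u, v} \<in> snd (H_graph R ps) \<longleftrightarrow> region (H_trapezoid u) \<inter> region (H_trapezoid v) \<noteq> {}"
    using trapezoid_graph_edge_iff[of u "R_H_upto R ps (length ps)" v] assms val[OF assms(1)]
      val[OF assms(2)] unfolding dom by (simp add: H_graph_def)
  also have "\<dots> \<longleftrightarrow> \<not> before u v \<and> \<not> before v u"
    using region_disjoint_iff[OF H_trapezoid_proper[OF assms(1)] H_trapezoid_proper[OF assms(2)]]
      H_trapezoid_before[OF assms] H_trapezoid_before[OF assms(2,1) assms(3)[symmetric]]
    by auto
  finally show ?thesis .
qed

section \<open>From parallelograms to an assignment\<close>

definition group_of :: "line_id \<Rightarrow> nat" where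
  "group_of l = (SOME t. t < length ps \<and> l \<in> group_lines t)"

lemma group_of:
  assumes "l \<in> L"
  shows "group_of l < length ps" "l \<in> group_lines (group_of l)"
  using someI_ex[OF ex_group[OF assms]] unfolding group_of_def by auto

lemma group_of_mate: "l \<in> L \<Longrightarrow> group_of (mate l) = group_of l"
  using group_unique[of "group_of (mate l)" "group_of l" "mate l"] group_of[of l]
    group_of[OF mate_in_L] group_lines_eq[of "group_of l" l] by auto

text \<open>The second and the fifth added parallelogram lie just outside the trapezoid of the group.\<close>

definition side :: "line_id \<Rightarrow> vertex" where
  "side l = (group_of l, if l = fst (ps ! group_of l) then 2 else 5)"

definition core :: "line_id \<Rightarrow> vertex" where
  "core l = (group_of l, 0)"

lemma core_side_in_H:
  assumes "l \<in> L"
  shows "core l \<in> fst (H_graph R ps)" "side l \<in> fst (H_graph R ps)"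
  using group_of[OF assms] by (auto simp: fst_H_graph core_def side_def)

lemma side_base:
  assumes "l \<in> L"
  shows "left_base (snd (side l)) (ps ! group_of l) = l" "right_base (snd (side l)) (ps ! group_of l) = l"
  using group_of[OF assms] by (auto simp: side_def left_base_def right_base_def group_lines_def)

text \<open>The gap between these two vertices marks the line \<open>l\<close>; in any parallelogram
  representation a substitute for \<open>l\<close> can be drawn in it.\<close>

lemma core_side_nonadjacent:
  assumes "l \<in> L"
  shows "core l \<noteq> side l" "{core l, side l} \<notin> snd (H_graph R ps)"
proof -
  show ne: "core l \<noteq> side l" by (auto simp: core_def side_def)
  show "{core l, side l} \<notin> snd (H_graph R ps)"
    unfolding H_edge_iff[OF core_side_in_H[OF assms] ne]
    by (auto simp: before_def core_def side_def group_before_def left_offset_def right_offset_def)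
qed

text \<open>Mates do not cross, so the groups differ. The base lines of each of these vertices
  enclose its line weakly, and an order of the vertices would therefore order the crossing
  lines.\<close>

lemma crossing_adjacent:
  assumes "p \<in> L" "q \<in> L" "always_cross p q" "u \<in> {core p, side p}" "v \<in> {core q, side q}"
  shows "u \<noteq> v \<and> {u, v} \<in> snd (H_graph R ps)"
proof -
  let ?t = "group_of p" and ?t' = "group_of q"
  have nl: "\<not> weakly_left_of (R p) (R q)" "\<not> weakly_left_of (R q) (R p)"
    using assms(3) arrangement_R by (auto simp: always_cross_def strictly_cross_def)
  have t: "?t \<noteq> ?t'"
  proof
    assume eq: "?t = ?t'"
    have "q \<in> {p, mate p}"
      using group_lines_eq[OF group_of[OF assms(1)]] group_of(2)[OF assms(2)] eq by simp
    then show False using nl mate_left_of[OF assms(1)] by (auto simp: weakly_left_of_def left_of_def)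
  qed
  have uv: "fst u = ?t" "fst v = ?t'" using assms(4,5) by (auto simp: core_def side_def)
  have bp: "weakly_left_of (R (left_base (snd u) (ps ! ?t))) (R p)"
    "weakly_left_of (R p) (R (right_base (snd u) (ps ! ?t)))"
    using assms(4) group_of[OF assms(1)] ps_nth(4)[OF group_of(1)[OF assms(1)]] side_base[OF assms(1)]
    by (auto simp: core_def left_base_def right_base_def group_lines_def weakly_left_of_def left_of_def)
  have bq: "weakly_left_of (R (left_base (snd v) (ps ! ?t'))) (R q)"
    "weakly_left_of (R q) (R (right_base (snd v) (ps ! ?t')))"
    using assms(5) group_of[OF assms(2)] ps_nth(4)[OF group_of(1)[OF assms(2)]] side_base[OF assms(2)]
    by (auto simp: core_def left_base_def right_base_def group_lines_def weakly_left_of_def left_of_def)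
  have "\<not> before u v" "\<not> before v u"
    using t nl bp bq unfolding before_def uv by (auto simp: weakly_left_of_def left_of_def)
  moreover have "u \<in> fst (H_graph R ps)" "v \<in> fst (H_graph R ps)" "u \<noteq> v"
    using core_side_in_H[OF assms(1)] core_side_in_H[OF assms(2)] assms(4,5) uv t by auto
  ultimately show ?thesis using H_edge_iff by blast
qed

text \<open>This concerns sides only: a core extends to the mate of its line and can meet trapezoids
  beyond that line.\<close>

lemma noncrossing_sides_nonadjacent:
  assumes "p \<in> L" "q \<in> L" "always_left p q"
  shows "side p \<noteq> side q \<and> {side p, side q} \<notin> snd (H_graph R ps)"
proof -
  have lt: "left_of (R p) (R q)" using assms(3) arrangement_R by (auto simp: always_left_def)
  have ne: "side p \<noteq> side q"
    using side_base[OF assms(1)] side_base[OF assms(2)] lt by (auto simp: side_def left_of_def)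
  have "before (side p) (side q)"
  proof (cases "group_of p = group_of q")
    case True
    then have "p = fst (ps ! group_of p)" "q \<noteq> fst (ps ! group_of p)"
      using group_of[OF assms(1)] group_of[OF assms(2)] ps_nth(4)[OF group_of(1)[OF assms(1)]] lt
      by (auto simp: group_lines_def left_of_def)
    then show ?thesis using True by (simp add: before_def side_def group_before_def)
  next
    case False
    then show ?thesis
      using side_base[OF assms(1)] side_base[OF assms(2)] lt by (simp add: before_def side_def)
  qed
  then show ?thesis
    using H_edge_iff[OF core_side_in_H(2)[OF assms(1)] core_side_in_H(2)[OF assms(2)] ne] ne by blast
qed

lemma var_clause:
  assumes "i < length \<phi>"
  shows "\<phi> ! i = {var \<phi> (i, 0), var \<phi> (i, 1), var \<phi> (i, 2)}"
proof -
  let ?xs = "sorted_list_of_set (\<phi> ! i)"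
  have C: "finite (\<phi> ! i)" "card (\<phi> ! i) = 3"
    using cnf assms by (auto simp: monotone_3cnf_def)
  then have "length ?xs = 3" by (metis length_sorted_list_of_set)
  then have "?xs = [?xs ! 0, ?xs ! 1, ?xs ! 2]"
    by (auto simp: list_eq_iff_nth_eq less_Suc_eq numeral_3_eq_3 numeral_2_eq_2)
  then have "set ?xs = {?xs ! 0, ?xs ! 1, ?xs ! 2}"
    by (metis list.set(1) list.set(2))
  then show ?thesis using C by (simp add: var_def)
qed

text \<open>Induction on the number of occurrences between \<open>x\<close> and \<open>y\<close>: if
  these are not consecutive, an occurrence of the same variable between them splits the range into
  two smaller ones.\<close>

lemma consecutive_invariant_imp_var_invariant:
  assumes step: "\<And>x y. consecutive \<phi> R x y \<Longrightarrow> f x = f y"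
    and "x \<in> occs \<phi>" "y \<in> occs \<phi>" "var \<phi> x = var \<phi> y"
  shows "f x = f y"
proof -
  define B where "B x y = {z \<in> occs \<phi>. occ_left R x z \<and> occ_left R z y}" for x y
  have fin: "finite (B x y)" for x y by (simp add: B_def occs_def)
  have main: "f x = f y"
    if "x \<in> occs \<phi>" "y \<in> occs \<phi>" "var \<phi> x = var \<phi> y" "occ_left R x y" for x y
    using that
  proof (induction "card (B x y)" arbitrary: x y rule: less_induct)
    case less
    show ?case
    proof (cases "consecutive \<phi> R x y")
      case False
      then obtain z where z: "z \<in> occs \<phi>" "var \<phi> z = var \<phi> x" "occ_left R x z" "occ_left R z y"
        using less.prems by (auto simp: consecutive_def)
      have "B x z \<subset> B x y" "B z y \<subset> B x y"
        using z occ_left_trans occ_left_irrefl unfolding B_def by blast+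
      then have "card (B x z) < card (B x y)" "card (B z y) < card (B x y)"
        using psubset_card_mono fin by blast+
      then show ?thesis using less.hyps[of x z] less.hyps[of z y] z less.prems by simp
    qed (rule step)
  qed
  show ?thesis
    using main[OF assms(2-4)] main[OF assms(3,2) assms(4)[symmetric]] occ_left_total[OF assms(2,3)]
    by metis
qed

lemma nae_satisfiable_if_parallelograms:
  assumes rep: "parallelogram_representation (H_graph R ps) P"
  shows "nae_satisfiable \<phi>"
proof -
  have adj: "{u, v} \<in> snd (H_graph R ps) \<longleftrightarrow> meets (P u) (P v)"
    if "u \<in> fst (H_graph R ps)" "v \<in> fst (H_graph R ps)" "u \<noteq> v" for u v
    using rep that by (auto simp: parallelogram_representation_def meets_def)
  have par: "slope (fst (P v)) = slope (snd (P v))" "weakly_left_of (fst (P v)) (snd (P v))"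
    if "v \<in> fst (H_graph R ps)" for v
    using rep that by (auto simp: parallelogram_representation_def)
  \<comment> \<open>The slope of the parallelogram of the group, which is therefore shared by
    mates.\<close>
  define D where "D l = slope (fst (P (core l)))" for l
  have D_mate: "D (mate l) = D l" if "l \<in> L" for l
    using group_of_mate[OF that] by (simp add: D_def core_def)
  have "\<forall>l\<in>L. \<exists>a. separates a (P (core l)) (P (side l)) \<and> slope a = D l"
  proof
    fix l assume l: "l \<in> L"
    have "\<not> meets (P (core l)) (P (side l))"
      using adj core_side_in_H[OF l] core_side_nonadjacent[OF l] by blast
    from exists_separating_line[OF this par(1)[OF core_side_in_H(1)[OF l]]]
    show "\<exists>a. separates a (P (core l)) (P (side l)) \<and> slope a = D l"
      unfolding D_def by blast
  qed
  then obtain a where a: "\<And>l. l \<in> L \<Longrightarrow> separates (a l) (P (core l)) (P (side l))"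
    and slope_a: "\<And>l. l \<in> L \<Longrightarrow> slope (a l) = D l"
    by metis
  have meet: "meets (P u) (P v)"
    if "p \<in> L" "q \<in> L" "always_cross p q" "u \<in> {core p, side p}" "v \<in> {core q, side q}" for p q u v
    using crossing_adjacent[OF that] adj core_side_in_H[OF that(1)] core_side_in_H[OF that(2)] that(4,5)
    by blast
  have D_neq: "D p \<noteq> D q" if "p \<in> L" "q \<in> L" "always_cross p q" for p q
    using separating_lines_cross[OF a[OF that(1)] a[OF that(2)]] meet[OF that] slope_a that
      not_weakly_left_imp_slope(2) by (metis insertI1 insertI2)
  have forcing: "D p < D q \<longleftrightarrow> D p < D r"
    if "p \<in> L" "q \<in> L" "r \<in> L" "always_cross p q" "always_cross p r"
      "always_left q r \<or> always_left r q" for p q r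
  proof -
    have "side q \<noteq> side r \<and> {side q, side r} \<notin> snd (H_graph R ps)"
      using that(6) noncrossing_sides_nonadjacent[OF that(2,3)]
        noncrossing_sides_nonadjacent[OF that(3,2)] insert_commute[of "side q" "side r" "{}"] by auto
    then have disjoint: "\<not> meets (P (side q)) (P (side r))"
      using adj[OF core_side_in_H(2)[OF that(2)] core_side_in_H(2)[OF that(3)]] by blast
    note q = meet[OF that(1,2,4)] and r = meet[OF that(1,3,5)]
    have "slope (a p) < slope (a q) \<longleftrightarrow> slope (a p) < slope (a r)"
      by (rule slope_forcing[OF a[OF that(1)] a[OF that(2)] a[OF that(3)] q q q q r r r r disjoint
            par(2)[OF core_side_in_H(2)[OF that(2)]] par(2)[OF core_side_in_H(2)[OF that(3)]]])
        simp_all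
    then show ?thesis using slope_a that by simp
  qed
  define f where "f x \<longleftrightarrow> D (Ell1 x) < D (Ell2 x)" for x
  have "f x = f y" if c: "consecutive \<phi> R x y" for x y
  proof -
    let ?w = "LinkU x y"
    have w: "?w \<in> {LinkU x y, LinkV x y}" by simp
    note xy = consecutiveD[OF c] and link = always_Link[OF c w]
    have mem: "Ell1 x \<in> L" "Ell2 x \<in> L" "Ell1 y \<in> L" "Ell2 y \<in> L" "?w \<in> L"
      using Ell_in_L xy Link_in_L[OF c w] by blast+
    \<comment> \<open>\<open>Ell1 x\<close> crosses both \<open>Ell2 x\<close> and the link, and
      these two do not cross each other.\<close>
    have "f x \<longleftrightarrow> D (Ell1 x) < D ?w"
      unfolding f_def using forcing[OF mem(1,2,5)] always_cross_Ell[OF xy(1)] link by blast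
    \<comment> \<open>Now the link is the line that crosses the two others; \<open>D_neq\<close>
      turns the negated inequalities around.\<close>
    also have "\<dots> \<longleftrightarrow> D (Ell1 y) < D ?w"
      using forcing[OF mem(5,1,3)] D_neq[OF mem(1,5)] D_neq[OF mem(3,5)] link always_cross_commute
        always_left_Ell[OF xy(4,1,2), of "Ell1 x" "Ell1 y"] by force
    also have "\<dots> \<longleftrightarrow> f y"
      unfolding f_def using forcing[OF mem(3,4,5)] always_cross_Ell[OF xy(2)] link by blast
    finally show ?thesis .
  qed
  note f_var = consecutive_invariant_imp_var_invariant[of f, OF this]
  \<comment> \<open>By \<open>f_var\<close> any single occurrence decides the value; variables
    without occurrences become false.\<close>
  define \<tau> where "\<tau> v \<longleftrightarrow> (\<exists>x\<in>occs \<phi>. var \<phi> x = v \<and> f x)" for v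
  have \<tau>: "\<tau> (var \<phi> x) \<longleftrightarrow> f x" if "x \<in> occs \<phi>" for x
    using f_var that unfolding \<tau>_def by blast
  have "(\<exists>x\<in>C. \<tau> x) \<and> (\<exists>x\<in>C. \<not> \<tau> x)" if C: "C \<in> set \<phi>" for C
  proof -
    obtain i where i: "i < length \<phi>" "C = \<phi> ! i" using C by (auto simp: in_set_conv_nth)
    have o: "(i, 0) \<in> occs \<phi>" "(i, 1) \<in> occs \<phi>" "(i, 2) \<in> occs \<phi>"
      using i by (auto simp: occs_def)
    have eq: "D (Ell2 (i, 1)) = D (Ell1 (i, 0))" "D (Ell2 (i, 2)) = D (Ell1 (i, 1))"
      "D (Ell2 (i, 0)) = D (Ell1 (i, 2))"
      using D_mate[OF Ell_in_L(1)[OF o(1)]] D_mate[OF Ell_in_L(1)[OF o(2)]]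
        D_mate[OF Ell_in_L(1)[OF o(3)]] by (simp_all add: numeral_2_eq_2)
    have neq: "D (Ell1 x) \<noteq> D (Ell2 x)" if "x \<in> occs \<phi>" for x
      using D_neq[OF Ell_in_L(1)[OF that] Ell_in_L(2)[OF that]] always_cross_Ell[OF that] .
    \<comment> \<open>If \<open>f\<close> held at all three positions, the identities
      \<open>eq\<close> would give \<open>D (Ell1 (i, 0)) < D (Ell1 (i, 2)) < D (Ell1 (i, 1)) < D
      (Ell1 (i, 0))\<close>; if it failed at all three, the reverse cycle would arise.\<close>
    have "\<not> (f (i, 0) \<and> f (i, 1) \<and> f (i, 2))" "f (i, 0) \<or> f (i, 1) \<or> f (i, 2)"
      using neq[OF o(1)] neq[OF o(2)] neq[OF o(3)] unfolding f_def eq by linarith+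
    then show ?thesis unfolding i(2) var_clause[OF i(1)] using \<tau> o by auto
  qed
  then show ?thesis unfolding nae_satisfiable_def by blast
qed

section \<open>From an assignment to parallelograms\<close>

text \<open>The spacing 10 is ample: in the layout the endpoints of \<open>Ell1 x\<close> and
  \<open>Ell2 x\<close> stay within distance 1 of \<open>pos x\<close>.\<close>

definition pos :: "occ \<Rightarrow> real" where
  "pos x = 10 * real (card {z \<in> occs \<phi>. occ_left R z x})"

lemma pos_mono:
  assumes "occ_left R x y" "x \<in> occs \<phi>"
  shows "pos x + 10 \<le> pos y"
proof -
  have "{z \<in> occs \<phi>. occ_left R z x} \<subset> {z \<in> occs \<phi>. occ_left R z y}"
    using assms occ_left_trans occ_left_irrefl by blast
  then have "card {z \<in> occs \<phi>. occ_left R z x} < card {z \<in> occs \<phi>. occ_left R z y}"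
    by (intro psubset_card_mono) (auto simp: occs_def)
  then show ?thesis by (simp add: pos_def)
qed

text \<open>In a clause that is not constant under \<open>\<tau>\<close>, the requirements on the slopes of its three
  groups form an acyclic tournament; the slope of a group is its number of smaller groups.\<close>

definition slope1 :: "(nat \<Rightarrow> bool) \<Rightarrow> occ \<Rightarrow> real" where
  "slope1 \<tau> x = of_bool (\<not> \<tau> (var \<phi> x)) + of_bool (\<tau> (var \<phi> (fst x, (snd x + 1) mod 3)))"

text \<open>\<open>Ell2\<close> shares its group with \<open>Ell1\<close> of the cyclically
  preceding position, which is reached by adding 2 modulo 3.\<close>

definition slope2 :: "(nat \<Rightarrow> bool) \<Rightarrow> occ \<Rightarrow> real" where
  "slope2 \<tau> x = slope1 \<tau> (fst x, (snd x + 2) mod 3)"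

definition nae :: "(nat \<Rightarrow> bool) \<Rightarrow> bool" where
  "nae \<tau> \<longleftrightarrow> (\<forall>C\<in>set \<phi>. (\<exists>x\<in>C. \<tau> x) \<and> (\<exists>x\<in>C. \<not> \<tau> x))"

lemma slope_bounds: "0 \<le> slope1 \<tau> x" "slope1 \<tau> x \<le> 2" "0 \<le> slope2 \<tau> x" "slope2 \<tau> x \<le> 2"
  by (auto simp: slope1_def slope2_def)

text \<open>Each position of a clause compares two cyclically adjacent groups. In a nonconstant
  clause the three comparisons are acyclic, and counting smaller groups realises them with integers,
  hence with differences of at least 1.\<close>

lemma slope1_slope2:
  assumes "nae \<tau>" "x \<in> occs \<phi>"
  shows "if \<tau> (var \<phi> x) then slope1 \<tau> x + 1 \<le> slope2 \<tau> x else slope2 \<tau> x + 1 \<le> slope1 \<tau> x"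
proof -
  obtain i j where x: "x = (i, j)" by fastforce
  have i: "i < length \<phi>" and j: "j = 0 \<or> j = 1 \<or> j = 2" using assms(2) x by (auto simp: occs_def)
  have "(\<exists>v\<in>\<phi> ! i. \<tau> v) \<and> (\<exists>v\<in>\<phi> ! i. \<not> \<tau> v)" using assms(1) i by (simp add: nae_def)
  then have "\<tau> (var \<phi> (i, 0)) \<or> \<tau> (var \<phi> (i, 1)) \<or> \<tau> (var \<phi> (i, 2))"
    "\<not> (\<tau> (var \<phi> (i, 0)) \<and> \<tau> (var \<phi> (i, 1)) \<and> \<tau> (var \<phi> (i, 2)))"
    unfolding var_clause[OF i] by auto
  then show ?thesis using j
    by (elim disjE) (auto simp: x slope1_def slope2_def numeral_2_eq_2)
qed

text \<open>The midpoint of \<open>slope1 \<tau> x / 2\<close> and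
  \<open>slope2 \<tau> x / 2\<close>, at distance at least 1/4 from both under an assignment
  satisfying \<open>nae\<close>.\<close>

definition mid :: "(nat \<Rightarrow> bool) \<Rightarrow> occ \<Rightarrow> real" where
  "mid \<tau> x = slope1 \<tau> x / 4 + slope2 \<tau> x / 4"

text \<open>One end lies between the endpoints of the two lines of \<open>x\<close>, the other
  between those of \<open>y\<close>; the value of the variable decides which of them is on
  L1.\<close>

definition link_line :: "(nat \<Rightarrow> bool) \<Rightarrow> occ \<Rightarrow> occ \<Rightarrow> line" where
  "link_line \<tau> x y = (if \<tau> (var \<phi> x) then (pos y + mid \<tau> y, pos x - mid \<tau> x)
     else (pos x + mid \<tau> x, pos y - mid \<tau> y))"

text \<open>The components of false variables are reflected: there \<open>Ell1 x\<close> gets the larger slope.\<close>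

fun layout :: "(nat \<Rightarrow> bool) \<Rightarrow> line_id \<Rightarrow> line" where
  "layout \<tau> (Ell1 x) = (pos x + slope1 \<tau> x / 2, pos x - slope1 \<tau> x / 2)"
| "layout \<tau> (Ell2 x) = (pos x + slope2 \<tau> x / 2, pos x - slope2 \<tau> x / 2)"
| "layout \<tau> (LinkU x y) = link_line \<tau> x y"
| "layout \<tau> (LinkV x y) =
     shift (if left_of (R (LinkU x y)) (R (LinkV x y)) then 1/8 else - 1/8) (link_line \<tau> x y)"

lemma arrangement_layout:
  assumes "nae \<tau>"
  shows "arrangement (layout \<tau>)"
  unfolding arrangement_def
proof (intro conjI ballI allI impI)
  fix x assume "x \<in> occs \<phi>"
  from slope1_slope2[OF assms this]
  show "strictly_cross (layout \<tau> (Ell1 x)) (layout \<tau> (Ell2 x))"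
    by (auto simp: strictly_cross_def weakly_left_of_def split: if_splits)
next
  fix x y assume "x \<in> occs \<phi>" "y \<in> occs \<phi>" "occ_left R x y"
  then have "pos x + 10 \<le> pos y" using pos_mono by blast
  then show "occ_left (layout \<tau>) x y"
    using slope_bounds[of \<tau> x] slope_bounds[of \<tau> y]
    by (auto simp: occ_left_def left_of_def)
next
  fix x y w assume c: "consecutive \<phi> R x y" and w: "w \<in> {LinkU x y, LinkV x y}"
  note xy = consecutiveD[OF c]
  have p: "pos x + 10 \<le> pos y" using pos_mono xy by blast
  \<comment> \<open>The shift of at most 1/8 stays below the margin 1/4 left by
    \<open>mid\<close>.\<close>
  obtain d where d: "layout \<tau> w = shift d (link_line \<tau> x y)" "- 1/8 \<le> d" "d \<le> 1/8"
  proof (cases "w = LinkU x y")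
    case True
    then show thesis using that[of 0] by (simp add: shift_def)
  next
    case False
    then show thesis
      using w that[of "if left_of (R (LinkU x y)) (R (LinkV x y)) then 1/8 else - 1/8"] by simp
  qed
  note facts = p d(2,3) slope1_slope2[OF assms xy(1)] slope1_slope2[OF assms xy(2)]
    slope_bounds[of \<tau> x] slope_bounds[of \<tau> y]
  have "left_of (layout \<tau> (Ell2 x)) (layout \<tau> w) \<and> left_of (layout \<tau> w) (layout \<tau> (Ell2 y)) \<and>
    strictly_cross (layout \<tau> (Ell1 x)) (layout \<tau> w) \<and> strictly_cross (layout \<tau> (Ell1 y)) (layout \<tau> w)"
  proof (cases "\<tau> (var \<phi> x)")
    case True
    then have "link_line \<tau> x y = (pos y + mid \<tau> y, pos x - mid \<tau> x)" "\<tau> (var \<phi> y)"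
      using xy by (auto simp: link_line_def)
    then show ?thesis
      using facts True
      by (auto simp: d(1) left_of_def shift_def mid_def strictly_cross_def weakly_left_of_def)
  next
    case False
    then have "link_line \<tau> x y = (pos x + mid \<tau> x, pos y - mid \<tau> y)" "\<not> \<tau> (var \<phi> y)"
      using xy by (auto simp: link_line_def)
    then show ?thesis
      using facts False
      by (auto simp: d(1) left_of_def shift_def mid_def strictly_cross_def weakly_left_of_def)
  qed
  then show "left_of (layout \<tau> (Ell2 x)) (layout \<tau> w)" "left_of (layout \<tau> w) (layout \<tau> (Ell2 y))"
    "strictly_cross (layout \<tau> (Ell1 x)) (layout \<tau> w)" "strictly_cross (layout \<tau> (Ell1 y)) (layout \<tau> w)"
    by blast+
next
  fix x y
  show "if left_of (R (LinkU x y)) (R (LinkV x y))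
         then left_of (layout \<tau> (LinkU x y)) (layout \<tau> (LinkV x y))
         else left_of (layout \<tau> (LinkV x y)) (layout \<tau> (LinkU x y))"
    by (auto simp: left_of_def shift_def)
qed

lemma slope_layout_mate:
  assumes "l \<in> L"
  shows "slope (layout \<tau> (mate l)) = slope (layout \<tau> l)"
  using assms
proof (cases rule: L_cases)
  case (1 x)
  obtain i j where x: "x = (i, j)" by fastforce
  have "((j + 1) mod 3 + 2) mod 3 = j" using 1 x by (auto simp: occs_def mod_simps)
  then show ?thesis using 1 x by (auto simp: slope_def slope2_def)
next
  case (2 x y)
  then show ?thesis by auto
qed

text \<open>The construction of the seven vertices per group is repeated with the lines of the
  layout, where mates are parallel. Both constructions induce the relation \<open>before\<close>, so
  adjacency is the same.\<close>

lemma parallelograms_if_nae: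
  assumes "nae \<tau>"
  shows "\<exists>P. parallelogram_representation (H_graph R ps) P"
proof -
  let ?S = "layout \<tau>"
  note arr = arrangement_layout[OF assms]
  have inj: "inj_on (\<lambda>l. fst (?S l)) L" "inj_on (\<lambda>l. snd (?S l)) L"
    using arrangement_endpoints_distinct[OF arr] unfolding inj_on_def by blast+
  obtain d1 where d1: "0 < d1"
    "\<And>p q. p \<in> L \<Longrightarrow> q \<in> L \<Longrightarrow> p \<noteq> q \<Longrightarrow> 2 * d1 < \<bar>fst (?S p) - fst (?S q)\<bar>"
    using finite_inj_separated[OF finite_L inj(1)] by blast
  obtain d2 where d2: "0 < d2"
    "\<And>p q. p \<in> L \<Longrightarrow> q \<in> L \<Longrightarrow> p \<noteq> q \<Longrightarrow> 2 * d2 < \<bar>snd (?S p) - snd (?S q)\<bar>"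
    using finite_inj_separated[OF finite_L inj(2)] by blast
  \<comment> \<open>A single distance for all groups, less than half of every gap between endpoints,
    replaces the successive values of \<open>eps\<close>.\<close>
  define d where "d = min d1 d2"
  have d: "0 < d" using d1 d2 by (simp add: d_def)
  have gap: "2 * d < \<bar>fst (?S p) - fst (?S q)\<bar>" "2 * d < \<bar>snd (?S p) - snd (?S q)\<bar>"
    if "p \<in> L" "q \<in> L" "p \<noteq> q" for p q
    using d1(2)[OF that] d2(2)[OF that] by (auto simp: d_def)
  define P where "P v = group_trapezoid d (map_prod ?S ?S (ps ! fst v)) (snd v)" for v :: vertex
  have pair: "map_prod ?S ?S (ps ! t) = (?S (fst (ps ! t)), ?S (snd (ps ! t)))" for t
    by (simp add: map_prod_def case_prod_beta)
  have lft: "left_of (?S (fst (ps ! t))) (?S (snd (ps ! t)))" if "t < length ps" for t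
    using arrangement_left_of_iff[OF arr ps_nth(1,3)[OF that]] ps_nth(4)[OF that] by blast
  have before_iff: "left_of (snd (P u)) (fst (P v)) \<longleftrightarrow> before u v"
    if uv: "u \<in> fst (H_graph R ps)" "v \<in> fst (H_graph R ps)" "u \<noteq> v" for u v
  proof -
    obtain t s t' s' where eq: "u = (t, s)" "v = (t', s')" by fastforce
    have b: "t < length ps" "t' < length ps" "s \<le> 6" "s' \<le> 6"
      using uv by (auto simp: eq fst_H_graph)
    show ?thesis
    proof (cases "t = t'")
      case True
      let ?p = "fst (ps ! t)" and ?q = "snd (ps ! t)"
      have ne: "?p \<noteq> ?q" using lft[OF b(1)] by (auto simp: left_of_def)
      have "d < fst (?S ?q) - fst (?S ?p)" "d < snd (?S ?q) - snd (?S ?p)"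
        using gap[OF ps_nth(1,3)[OF b(1)] ne] lft[OF b(1)] d by (auto simp: left_of_def)
      \<comment> \<open>The strict form is required, since touching parallelograms would count as
        adjacent.\<close>
      then show ?thesis
        using group_before_iff(2)[OF lft[OF b(1)] d _ _ b(3,4)] True uv(3)
        by (simp add: P_def before_def eq pair)
    next
      case False
      define l where "l = right_base s (ps ! t)"
      define l' where "l' = left_base s' (ps ! t')"
      have g: "l \<in> group_lines t" "l' \<in> group_lines t'"
        using base_in_group_lines by (auto simp: l_def l'_def)
      then have mem: "l \<in> L" "l' \<in> L" using group_lines_subset b by auto
      have "l \<noteq> l'" using group_unique[OF b(1,2)] g False by blast
      note gap' = gap[OF mem this]
      have "\<bar>right_offset s * d\<bar> < d" "\<bar>left_offset s' * d\<bar> < d"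
        using scaled_abs_less offset_bounds b d by auto
      then have "fst (?S l) + right_offset s * d < fst (?S l') + left_offset s' * d \<longleftrightarrow> fst (?S l) < fst (?S l')"
        "snd (?S l) + right_offset s * d < snd (?S l') + left_offset s' * d \<longleftrightarrow> snd (?S l) < snd (?S l')"
        using gap' by auto
      then have "left_of (snd (P u)) (fst (P v)) \<longleftrightarrow> left_of (?S l) (?S l')"
        by (simp add: P_def eq group_trapezoid_def shift_def base_map_prod left_of_def l_def l'_def)
      also have "\<dots> \<longleftrightarrow> left_of (R l) (R l')" by (rule arrangement_left_of_iff[OF arr mem])
      finally show ?thesis using False by (simp add: before_def eq l_def l'_def)
    qed
  qed
  have "parallelogram_representation (H_graph R ps) P"
    unfolding parallelogram_representation_def
  proof (intro conjI ballI impI)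
    fix v assume v: "v \<in> fst (H_graph R ps)"
    then have t: "fst v < length ps" "snd v \<le> 6" by (auto simp: fst_H_graph)
    show "slope (fst (P v)) = slope (snd (P v))"
      using slope_layout_mate[OF ps_nth(1)[OF t(1)], of \<tau>] ps_nth(2)[OF t(1)]
      by (auto simp: P_def group_trapezoid_def base_map_prod left_base_def right_base_def)
    show "weakly_left_of (fst (P v)) (snd (P v))"
      using left_of_group_trapezoid[OF lft[OF t(1)] d t(2)]
      by (auto simp: P_def pair left_of_def weakly_left_of_def)
  next
    fix u v assume uv: "u \<in> fst (H_graph R ps)" "v \<in> fst (H_graph R ps)" "u \<noteq> v"
    show "({u, v} \<in> snd (H_graph R ps)) =
      (\<not> left_of (snd (P u)) (fst (P v)) \<and> \<not> left_of (snd (P v)) (fst (P u)))"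
      unfolding before_iff[OF uv] before_iff[OF uv(2,1) uv(3)[symmetric]] by (rule H_edge_iff[OF uv])
  qed
  then show ?thesis by blast
qed

lemma nae_satisfiable_iff_bounded_tolerance:
  "nae_satisfiable \<phi> \<longleftrightarrow> bounded_tolerance_graph (H_graph R ps)"
proof
  assume "nae_satisfiable \<phi>"
  then obtain \<tau> where "nae \<tau>" unfolding nae_satisfiable_def nae_def by blast
  from parallelograms_if_nae[OF this] show "bounded_tolerance_graph (H_graph R ps)"
    using parallelogram_imp_bounded_tolerance finite_vertices by blast
next
  assume "bounded_tolerance_graph (H_graph R ps)"
  then show "nae_satisfiable \<phi>"
    using bounded_tolerance_imp_parallelogram nae_satisfiable_if_parallelograms by blast
qed

end

theorem theorem3p2:
  fixes \<phi> :: formula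
    and R :: "line_id \<Rightarrow> line"
    and ps :: "(line_id \<times> line_id) list"
  assumes "monotone_3cnf \<phi>"
    and "perm_representation \<phi> R"
    and "enumerates_groups \<phi> R ps"
  shows "nae_satisfiable \<phi> \<longleftrightarrow> bounded_tolerance_graph (H_graph R ps)"
proof -
  interpret formula_representation \<phi> R ps using assms by unfold_locales
  show ?thesis by (rule nae_satisfiable_iff_bounded_tolerance)
qed

end
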